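(* Let $\Phi:\mathbb{R}^n\to 2^{\mathbb{R}^n}$ be a set-valued mapping with nonempty, closed and convex values, and let $f:\mathbb{R}^n\to\mathbb{R}^n$ be $L$-Lipschitz continuous and $\beta$-strongly monotone ($\beta>0$). Let $\alpha>0$, and assume that there exists $\mu>0$ such that $$\|P_{\Phi(u)}(w)-P_{\Phi(v)}(w)\|\le \mu\|u-v\|\quad\text{for all } u,v,w\in\mathbb{R}^n,$$ and $$\sqrt{L^2+\alpha^2-2\alpha\beta}+\mu<\alpha .$$ Assume further that $$\sqrt{L^2+\alpha^2-2\alpha\beta}+\mu<\beta .$$ Let $a_1,a_2>0$, $r_1\in(0,1)$, $r_2>1$, and consider the dynamical system $$\dot u=-\psi(u)\bigl(f(u)-P_{\Phi(u)}(f(u)-\alpha u)\bigr),$$ where, writing $R(u)=f(u)-P_{\Phi(u)}(f(u)-\alpha u)$, $$\psi(u)=\frac{a_1}{\|R(u)\|^{1-r_1}}+\frac{a_2}{\|R(u)\|^{1-r_2}}\ \text{ if } R(u)\ne0,\qquad \psi(u)=0\ \text{ if } R(u)=0 .$$ Let $u^*\in\mathbb{R}^n$ be an equilibrium point of this dynamical system. Then $u^*$, the solution of the inverse quasi-variational inequality problem associated with $(f,\Phi)$, is a globally fixed-time stable equilibrium point of the dynamical system (for any $r_1\in(0,1)$ and $r_2>1$), and there exist $s_1>0$, $s_2>0$, $b_1\in(0.5,1)$, $b_2>1$ such that for every initial point $u(0)$ $$T(u(0))\le T_{\max}=\frac{1}{s_1(1-b_1)}+\frac{1}{s_2(b_2-1)}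 .$$ In addition, if $b_1=1-\frac{1}{2\xi}$ and $b_2=1+\frac{1}{2\xi}$ with $\xi>1$, then for every initial point $u(0)$ $$T(u(0))\le T_{\max}=\frac{\pi\xi}{\sqrt{s_1s_2}} .$$
   Context: $\langle\cdot,\cdot\rangle$ and $\|\cdot\|$ are the inner product and norm of $\mathbb{R}^n$. For a nonempty closed convex set $C\subseteq\mathbb{R}^n$, $P_C(u)$ is the metric projection of $u$ onto $C$. The map $f$ is $L$-Lipschitz if $\|f(u)-f(v)\|\le L\|u-v\|$ and $\beta$-strongly monotone if $\langle f(u)-f(v),u-v\rangle\ge\beta\|u-v\|^2$ for all $u,v$. Inverse quasi-variational inequality problem (IQVIP) associated with $(f,\Phi)$: find $u^*\in\mathbb{R}^n$ such that $f(u^* )\in\Phi(u^* )$ and $\langle u^*,y-f(u^* )\rangle\ge 0$ for all $y\in\Phi(u^* )$. (Under the first group of hypotheses the IQVIP is known to have a unique solution.) Stability notions. Consider $\dot u(t)=G(u(t))$, $t\ge0$, with $G:\mathbb{R}^n\to\mathbb{R}^n$ continuous. A point $u^*$ is an equilibrium point if $G(u^* )=0$. It is globally finite-time stable if (i) it is Lyapunov stable: for every $\epsilon>0$ there is $\delta>0$ such that for every $u_0$ in the open ball $B(u^*,\delta)$ the solution with $u(0)=u_0$ exists and lies in $B(u^*,\epsilon)$ for all $t>0$; and (ii) there is a settling-time function $T:\mathbb{R}^n\setminus\{u^*\}\to(0,\infty)$ such that for every $u(0)\in \mathbb{R}^n\setminus\{u^*\}$ the solution satisfies $u(t)\ne u^*$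 for all $t\in[0,T(u(0)))$ and $\lim_{t\to T(u(0))}u(t)=u^*$. It is (globally) fixed-time stable if it is globally finite-time stable and $\sup_{u(0)}T(u(0))<\infty$. *)

theory Defs
  imports "HOL-Analysis.Analysis"
begin

definition strongly_monotone :: "real \<Rightarrow> (real ^ 'n \<Rightarrow> real ^ 'n) \<Rightarrow> bool" where
  "strongly_monotone \<beta> f \<longleftrightarrow>
     (\<forall>u v. (f u - f v) \<bullet> (u - v) \<ge> \<beta> * (norm (u - v))\<^sup>2)"

definition iqvip_solution ::
    "(real ^ 'n \<Rightarrow> real ^ 'n) \<Rightarrow> (real ^ 'n \<Rightarrow> (real ^ 'n) set) \<Rightarrow> real ^ 'n \<Rightarrow> bool" where
  "iqvip_solution f \<Phi> u \<longleftrightarrow> f u \<in> \<Phi> u \<and> (\<forall>y\<in>\<Phi> u. u \<bullet> (y - f u) \<ge> 0)"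


section \<open>Stability of autonomous differential equations\<close>

definition ivp_solution ::
    "(real ^ 'n \<Rightarrow> real ^ 'n) \<Rightarrow> real ^ 'n \<Rightarrow> (real \<Rightarrow> real ^ 'n) \<Rightarrow> bool" where
  "ivp_solution G u0 u \<longleftrightarrow>
     u 0 = u0 \<and> (\<forall>t\<ge>0. (u has_vector_derivative G (u t)) (at t within {0..}))"

text \<open>``The solution'' is read as existence together with uniqueness. Trajectories are total
  functions on the reals, so uniqueness can only be asked for nonnegative times.\<close>

definition the_ivp_solution ::
    "(real ^ 'n \<Rightarrow> real ^ 'n) \<Rightarrow> real ^ 'n \<Rightarrow> (real \<Rightarrow> real ^ 'n) \<Rightarrow> bool" where
  "the_ivp_solution G u0 u \<longleftrightarrow>
     ivp_solution G u0 u \<and> (\<forall>v. ivp_solution G u0 v \<longrightarrow> (\<forall>t\<ge>0. v t = u t))"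

definition equilibrium_point :: "(real ^ 'n \<Rightarrow> real ^ 'n) \<Rightarrow> real ^ 'n \<Rightarrow> bool" where
  "equilibrium_point G p \<longleftrightarrow> G p = 0"

definition lyapunov_stable :: "(real ^ 'n \<Rightarrow> real ^ 'n) \<Rightarrow> real ^ 'n \<Rightarrow> bool" where
  "lyapunov_stable G p \<longleftrightarrow>
     (\<forall>\<epsilon>>0. \<exists>\<delta>>0. \<forall>u0\<in>ball p \<delta>.
        \<exists>u. the_ivp_solution G u0 u \<and> (\<forall>t>0. u t \<in> ball p \<epsilon>))"

text \<open>A settling-time function has domain \<open>- {p}\<close>; the value \<open>T p\<close> is irrelevant.\<close>

definition settling_time_function ::
    "(real ^ 'n \<Rightarrow> real ^ 'n) \<Rightarrow> real ^ 'n \<Rightarrow> (real ^ 'n \<Rightarrow> real) \<Rightarrow> bool" where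
  "settling_time_function G p T \<longleftrightarrow>
     (\<forall>u0. u0 \<noteq> p \<longrightarrow>
        T u0 > 0 \<and>
        (\<exists>u. the_ivp_solution G u0 u \<and>
             (\<forall>t\<in>{0..<T u0}. u t \<noteq> p) \<and> (u \<longlongrightarrow> p) (at (T u0))))"

text \<open>The continuity of the vector field and the equilibrium property, which are presupposed
  whenever these stability notions are used, are made part of the definitions.\<close>

definition globally_finite_time_stable :: "(real ^ 'n \<Rightarrow> real ^ 'n) \<Rightarrow> real ^ 'n \<Rightarrow> bool" where
  "globally_finite_time_stable G p \<longleftrightarrow>
     continuous_on UNIV G \<and> equilibrium_point G p \<and>
     lyapunov_stable G p \<and> (\<exists>T. settling_time_function G p T)"

definition globally_fixed_time_stable :: "(real ^ 'n \<Rightarrow> real ^ 'n) \<Rightarrow> real ^ 'n \<Rightarrow> bool" where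
  "globally_fixed_time_stable G p \<longleftrightarrow>
     globally_finite_time_stable G p \<and>
     (\<exists>T. settling_time_function G p T \<and> bdd_above (T ` (- {p})))"


section \<open>The projection dynamical system\<close>

definition residual ::
    "(real ^ 'n \<Rightarrow> real ^ 'n) \<Rightarrow> (real ^ 'n \<Rightarrow> (real ^ 'n) set) \<Rightarrow> real \<Rightarrow>
     real ^ 'n \<Rightarrow> real ^ 'n" where
  "residual f \<Phi> \<alpha> u = f u - closest_point (\<Phi> u) (f u - \<alpha> *\<^sub>R u)"

definition gain ::
    "(real ^ 'n \<Rightarrow> real ^ 'n) \<Rightarrow> (real ^ 'n \<Rightarrow> (real ^ 'n) set) \<Rightarrow> real \<Rightarrow>
     real \<Rightarrow> real \<Rightarrow> real \<Rightarrow> real \<Rightarrow> real ^ 'n \<Rightarrow> real" where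
  "gain f \<Phi> \<alpha> a1 a2 r1 r2 u =
     (if residual f \<Phi> \<alpha> u \<noteq> 0
      then a1 / norm (residual f \<Phi> \<alpha> u) powr (1 - r1)
         + a2 / norm (residual f \<Phi> \<alpha> u) powr (1 - r2)
      else 0)"

definition iqvip_field ::
    "(real ^ 'n \<Rightarrow> real ^ 'n) \<Rightarrow> (real ^ 'n \<Rightarrow> (real ^ 'n) set) \<Rightarrow> real \<Rightarrow>
     real \<Rightarrow> real \<Rightarrow> real \<Rightarrow> real \<Rightarrow> real ^ 'n \<Rightarrow> real ^ 'n" where
  "iqvip_field f \<Phi> \<alpha> a1 a2 r1 r2 u =
     - (gain f \<Phi> \<alpha> a1 a2 r1 r2 u *\<^sub>R residual f \<Phi> \<alpha> u)"

end

theory Submission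
  imports Defs
begin

text \<open>
  Write \<open>R\<close> for the residual and \<open>\<theta> = sqrt (L\<^sup>2 + \<alpha>\<^sup>2 - 2\<alpha>\<beta>) + \<mu>\<close>. Projections are nonexpansive, and
  \<open>f - \<alpha> id\<close> is Lipschitz with the square root as constant, so \<open>u \<mapsto> P\<^bsub>\<Phi>(u)\<^esub> (f u - \<alpha> u)\<close> is
  \<open>\<theta>\<close>-Lipschitz. Subtracting it from the \<open>\<beta>\<close>-strongly monotone \<open>f\<close> leaves \<open>R\<close> Lipschitz and strongly
  monotone with constant \<open>\<beta> - \<theta> > 0\<close>. Zeros of \<open>R\<close> are the solutions of the IQVIP, by the
  variational characterization of projections, so the equilibrium is the only solution. From here
  on only a Lipschitz field \<open>R\<close> that vanishes at \<open>p\<close> and satisfies \<open>R u \<bullet> (u - p) \<ge> c |u - p|\<^sup>2\<close> matters.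

  The right-hand side \<open>- \<psi>(|R u|) R u\<close> is continuous but not Lipschitz at \<open>p\<close>, and solutions reach
  \<open>p\<close> in finite time. It has, however, the orbits of \<open>v' = - R v\<close>, whose
  solutions exist globally by Picard iteration and never reach \<open>p\<close>. Running along such an orbit
  with the clock \<open>h(s) = \<integral>\<^sub>0\<^sup>s d\<sigma> / \<psi>(|R (v \<sigma>)|)\<close> solves the original equation up to the time
  \<open>T = lim h\<close>, after which the trajectory rests at \<open>p\<close>. Conversely any solution, before it reaches
  \<open>p\<close>, is \<open>v\<close> in another time scale, and that time scale must be the inverse of \<open>h\<close>. This gives
  existence and uniqueness.

  The settling time is bounded with the Lyapunov function \<open>arctan (|u - p|\<^bsup>2\<kappa>\<^esup>)\<close>, where
  \<open>2\<kappa> = min (1 - r\<^sub>1) (r\<^sub>2 - 1)\<close>. Up to a constant, \<open>\<psi>(|R u|)\<close> is at least \<open>X\<^sup>-\<^sup>1 + X\<close> for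
  \<open>X = |u - p|\<^bsup>2\<kappa>\<^esup>\<close>; the factor \<open>1 / (1 + X\<^sup>2)\<close> in the derivative of \<open>arctan X\<close> cancels exactly this
  growth, so the Lyapunov function falls at a rate bounded away from \<open>0\<close>. Being
  bounded by \<open>\<pi>/2\<close>, it allows at most the time \<open>\<pi> / (2 rate)\<close>, whatever the initial point. This one
  bound \<open>M\<close> is of the form \<open>\<pi> \<xi> / sqrt (s\<^sub>1 s\<^sub>2)\<close> for every \<open>\<xi>\<close>, by the choice
  \<open>s\<^sub>1 = s\<^sub>2 = \<pi> \<xi> / M\<close>, and the other expression for the maximal settling time is then \<open>4 M / \<pi> \<ge> M\<close>.
\<close>

section \<open>Differential inequalities and initial value problems\<close>

lemma antiderivative_on_reals:
  fixes g :: "real \<Rightarrow> 'a::euclidean_space"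
  assumes "continuous_on UNIV g"
  obtains G where "G 0 = 0" "\<And>t. (G has_vector_derivative g t) (at t)"
proof -
  have "\<exists>F. \<forall>x::real. - \<infinity> < ereal x \<longrightarrow> ereal x < \<infinity> \<longrightarrow> (F has_vector_derivative g x) (at x)"
    by (rule einterval_antiderivative)
       (use assms in \<open>auto simp: continuous_on_eq_continuous_at\<close>)
  then obtain F where F: "\<And>x. (F has_vector_derivative g x) (at x)" by auto
  show thesis
    by (rule that[of "\<lambda>t. F t - F 0"]) (auto intro!: derivative_eq_intros F)
qed

text \<open>
  Multiply by the integrating factor \<open>exp (- \<theta>)\<close>. The rate \<open>\<theta>'\<close> is given through its antiderivative,
  which lets the lemma compare motions in a variable time scale, and \<open>E\<close> may be negative, so the
  lemma also yields lower bounds.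
\<close>

lemma gronwall_differential:
  fixes E \<theta> :: "real \<Rightarrow> real"
  assumes "a \<le> b" "continuous_on {a..b} E" "continuous_on {a..b} \<theta>"
    and E': "\<And>t. a < t \<Longrightarrow> t < b \<Longrightarrow> (E has_real_derivative E' t) (at t)"
    and \<theta>': "\<And>t. a < t \<Longrightarrow> t < b \<Longrightarrow> (\<theta> has_real_derivative \<theta>' t) (at t)"
    and le: "\<And>t. a < t \<Longrightarrow> t < b \<Longrightarrow> E' t \<le> \<theta>' t * E t"
  shows "E b \<le> E a * exp (\<theta> b - \<theta> a)"
proof -
  have "E b * exp (- \<theta> b) \<le> E a * exp (- \<theta> a)"
  proof (rule DERIV_nonpos_imp_decreasing_open[OF \<open>a \<le> b\<close>])
    fix t assume t: "a < t" "t < b"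
    have "((\<lambda>t. E t * exp (- \<theta> t)) has_real_derivative (E' t - \<theta>' t * E t) * exp (- \<theta> t)) (at t)"
      by (rule derivative_eq_intros E'[OF t] \<theta>'[OF t] refl)+ (simp add: algebra_simps)
    moreover have "(E' t - \<theta>' t * E t) * exp (- \<theta> t) \<le> 0"
      using le[OF t] by (simp add: mult_le_0_iff)
    ultimately show "\<exists>y. ((\<lambda>t. E t * exp (- \<theta> t)) has_real_derivative y) (at t) \<and> y \<le> 0"
      by blast
  qed (intro continuous_intros assms)
  then have "E b * exp (- \<theta> b) * exp (\<theta> b) \<le> E a * exp (- \<theta> a) * exp (\<theta> b)"
    by (rule mult_right_mono) simp
  then show ?thesis
    by (simp add: mult.assoc flip: exp_add)
qed

lemma norm_sq_has_derivative:
  assumes "(x has_vector_derivative x') (at t)"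
  shows "((\<lambda>t. (norm (x t - p))\<^sup>2) has_real_derivative 2 * (x' \<bullet> (x t - p))) (at t)"
proof -
  have "((\<lambda>t. (x t - p) \<bullet> (x t - p)) has_vector_derivative 2 * (x' \<bullet> (x t - p))) (at t)"
    using assms unfolding has_vector_derivative_def
    by (auto intro!: derivative_eq_intros simp: inner_commute algebra_simps)
  then show ?thesis
    by (simp add: power2_norm_eq_inner has_real_derivative_iff_has_vector_derivative)
qed

text \<open>
  Global existence for a globally Lipschitz field. In the norm \<open>sup e\<^sup>-\<^sup>\<Lambda>\<^sup>t |v t - v0|\<close> with
  \<open>\<Lambda> > K\<close> the Picard operator contracts on the whole half-line at once, not only on a short
  interval. The solution is delivered on the whole real line, with the equation only at
  nonnegative times, so that the derivative at \<open>0\<close> is two-sided.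
\<close>

lemma lipschitz_ivp_exists:
  fixes F :: "'a::euclidean_space \<Rightarrow> 'a"
  assumes F: "K-lipschitz_on UNIV F"
  obtains v where "v 0 = v0" "continuous_on UNIV v"
    "\<And>t. t \<ge> 0 \<Longrightarrow> (v has_vector_derivative F (v t)) (at t)"
proof -
  have K: "K \<ge> 0" using F lipschitz_on_nonneg by blast
  have Flip: "norm (F x - F y) \<le> K * norm (x - y)" for x y
    using lipschitz_onD[OF F, of x y] by (simp add: dist_norm)
  have Fcont: "continuous_on UNIV F" using F lipschitz_on_continuous_on by blast
  define \<Lambda> where "\<Lambda> = K + 1"
  have \<Lambda>: "\<Lambda> > 0" using K by (simp add: \<Lambda>_def)
  \<comment> \<open>The unknown is the weighted deviation \<open>w t = exp (- \<Lambda> * t) *\<^sub>R (v t - v0)\<close>, an element of the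
      Banach space of bounded continuous functions; \<open>X w\<close> recovers the candidate trajectory.\<close>
  define X where "X w t = v0 + exp (\<Lambda> * t) *\<^sub>R apply_bcontfun w t" for w t
  have FX: "continuous_on UNIV (\<lambda>t. F (X w t))" for w
    unfolding X_def by (intro continuous_on_compose2[OF Fcont] continuous_intros) auto
  have "\<exists>J. J 0 = 0 \<and> (\<forall>t. (J has_vector_derivative F (X w t)) (at t))" for w
    by (rule antiderivative_on_reals[OF FX]) blast
  then obtain J where J0: "\<And>w. J w 0 = 0"
    and J: "\<And>w t. (J w has_vector_derivative F (X w t)) (at t)" by metis
  have Jcont: "continuous_on S (J w)" for S w
    by (rule continuous_on_vector_derivative[OF has_vector_derivative_at_within[OF J]])
  \<comment> \<open>An integrand that grows at most like the weight has an integral bounded by the weight over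
      \<open>\<Lambda>\<close>; the factor \<open>1 / \<Lambda>\<close> is the gain that turns the Picard operator into a contraction.\<close>
  have grow: "norm (g t) \<le> C / \<Lambda> * exp (\<Lambda> * t)"
    if t: "t \<ge> 0" and C: "C \<ge> 0" and g0: "g 0 = 0"
      and g': "\<And>s. (g has_vector_derivative g' s) (at s)"
      and le: "\<And>s. s > 0 \<Longrightarrow> norm (g' s) \<le> C * exp (\<Lambda> * s)" for g :: "real \<Rightarrow> 'a" and g' C t
  proof (cases "t = 0")
    case True then show ?thesis using C \<Lambda> g0 by simp
  next
    case False
    have "norm (g t - g 0) \<le> C / \<Lambda> * exp (\<Lambda> * t) - C / \<Lambda> * exp (\<Lambda> * 0)"
    proof (rule differentiable_bound_general)
      show "0 < t" using False t by simp
      show "continuous_on {0..t} g"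
        by (rule continuous_on_vector_derivative[OF has_vector_derivative_at_within[OF g']])
      show "((\<lambda>s. C / \<Lambda> * exp (\<Lambda> * s)) has_vector_derivative C * exp (\<Lambda> * s)) (at s)" for s
        unfolding has_real_derivative_iff_has_vector_derivative[symmetric]
        by (rule derivative_eq_intros refl)+ (use \<Lambda> in simp)
      show "continuous_on {0..t} (\<lambda>s. C / \<Lambda> * exp (\<Lambda> * s))" by (intro continuous_intros)
    qed (use g' le in auto)
    moreover have "C / \<Lambda> \<ge> 0" using C \<Lambda> by simp
    ultimately show ?thesis
      unfolding g0 diff_zero mult_zero_right exp_zero mult_1_right by linarith
  qed
  \<comment> \<open>Extended by its value at \<open>0\<close> to negative times, where the weight would not keep it bounded.\<close>
  define A where "A w t = exp (- \<Lambda> * max 0 t) *\<^sub>R J w (max 0 t)" for w t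
  have A_bound: "norm (A w t) \<le> (norm (F v0) + K * norm w) / \<Lambda>" for w t
  proof -
    define s where "s = max 0 t"
    have "norm (J w s) \<le> (norm (F v0) + K * norm w) / \<Lambda> * exp (\<Lambda> * s)"
    proof (rule grow[OF _ _ J0 J])
      fix r :: real assume r: "r > 0"
      have "norm (F (X w r)) \<le> norm (F v0) + K * norm (X w r - v0)"
        using Flip[of "X w r" v0] norm_triangle_ineq2[of "F (X w r)" "F v0"] by linarith
      also have "norm (X w r - v0) \<le> exp (\<Lambda> * r) * norm w"
        by (simp add: X_def norm_bounded)
      finally have "norm (F (X w r)) \<le> norm (F v0) * 1 + K * (exp (\<Lambda> * r) * norm w)"
        using K by (simp add: mult_left_mono)
      also have "\<dots> \<le> norm (F v0) * exp (\<Lambda> * r) + K * (exp (\<Lambda> * r) * norm w)"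
        using \<Lambda> r K by (intro add_mono mult_left_mono) auto
      finally show "norm (F (X w r)) \<le> (norm (F v0) + K * norm w) * exp (\<Lambda> * r)"
        by (simp add: algebra_simps)
    qed (use K in \<open>auto simp: s_def\<close>)
    then have "exp (- \<Lambda> * s) * norm (J w s)
        \<le> exp (- \<Lambda> * s) * ((norm (F v0) + K * norm w) / \<Lambda> * exp (\<Lambda> * s))"
      by (rule mult_left_mono) simp
    also have "\<dots> = (norm (F v0) + K * norm w) / \<Lambda>"
      by (simp add: exp_minus)
    finally show ?thesis by (simp add: A_def s_def)
  qed
  have A_cont: "continuous_on UNIV (A w)" for w
    unfolding A_def by (intro continuous_intros continuous_on_compose2[OF Jcont[of UNIV]]) auto
  define P where "P w = Bcontfun (A w)" for w
  have P: "apply_bcontfun (P w) = A w" for w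
    unfolding P_def by (rule Bcontfun_inverse[OF bcontfun_normI[OF A_cont A_bound]])
  have "\<exists>!w. P w = w"
  proof (rule banach_fix_type)
    show "0 \<le> K / \<Lambda>" "K / \<Lambda> < 1" using K by (simp_all add: \<Lambda>_def)
    show "\<forall>w z. dist (P w) (P z) \<le> K / \<Lambda> * dist w z"
    proof (intro allI dist_bound)
      fix w z and t :: real
      define s where "s = max 0 t"
      have "norm (J w s - J z s) \<le> K * dist w z / \<Lambda> * exp (\<Lambda> * s)"
      proof (rule grow[where g = "\<lambda>s. J w s - J z s"])
        show "((\<lambda>s. J w s - J z s) has_vector_derivative F (X w r) - F (X z r)) (at r)" for r
          by (intro has_vector_derivative_diff J)
        show "norm (F (X w r) - F (X z r)) \<le> K * dist w z * exp (\<Lambda> * r)" for r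
        proof -
          have "norm (X w r - X z r) = exp (\<Lambda> * r) * dist (apply_bcontfun w r) (apply_bcontfun z r)"
            by (simp add: X_def dist_norm flip: scaleR_diff_right)
          also have "\<dots> \<le> exp (\<Lambda> * r) * dist w z" by (simp add: dist_bounded)
          finally show ?thesis
            using Flip[of "X w r" "X z r"] K
              mult_left_mono[of "norm (X w r - X z r)" "exp (\<Lambda> * r) * dist w z" K]
            by (simp add: algebra_simps)
        qed
      qed (use K J0 in \<open>auto simp: s_def\<close>)
      then have "exp (- \<Lambda> * s) * norm (J w s - J z s)
          \<le> exp (- \<Lambda> * s) * (K * dist w z / \<Lambda> * exp (\<Lambda> * s))"
        by (rule mult_left_mono) simp
      also have "\<dots> = K / \<Lambda> * dist w z"
        by (simp add: exp_minus)
      finally show "dist (apply_bcontfun (P w) t) (apply_bcontfun (P z) t) \<le> K / \<Lambda> * dist w z"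
        by (simp add: P A_def s_def dist_norm flip: scaleR_diff_right)
    qed
  qed
  then obtain w where "P w = w" by auto
  then have w: "apply_bcontfun w t = A w t" for t using P by metis
  have Xw: "X w t = v0 + J w t" if "t \<ge> 0" for t
    using that by (simp add: X_def w A_def exp_minus)
  show thesis
  proof (rule that[of "\<lambda>t. v0 + J w t"])
    show "((\<lambda>t. v0 + J w t) has_vector_derivative F (v0 + J w t)) (at t)" if "t \<ge> 0" for t
      using has_vector_derivative_add[OF has_vector_derivative_const[of v0] J[of w t]] Xw[OF that]
      by simp
  qed (use J0 Jcont in \<open>auto intro!: continuous_intros\<close>)
qed

lemma ivp_solutionD:
  assumes u: "ivp_solution G u0 u"
  shows "u 0 = u0" "continuous_on {0..} u"
    "t > 0 \<Longrightarrow> (u has_vector_derivative G (u t)) (at t)"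
proof -
  show "(u has_vector_derivative G (u t)) (at t)" if "t > 0"
  proof -
    have "(u has_vector_derivative G (u t)) (at t within {0..})"
      using u that by (auto simp: ivp_solution_def)
    then have "(u has_vector_derivative G (u t)) (at t within {0<..})"
      by (rule has_vector_derivative_within_subset) auto
    then show ?thesis
      using that by (subst (asm) has_vector_derivative_within_open) auto
  qed
qed (use u in \<open>auto simp: ivp_solution_def intro!: continuous_on_vector_derivative\<close>)

text \<open>
  Finitely many exceptional times are harmless: the fundamental theorem of calculus ignores them, so a
  continuous \<open>u\<close> satisfies the integral equation, whose continuous integrand makes \<open>u\<close> differentiable
  everywhere, including one-sidedly at \<open>0\<close>.
\<close>

lemma ivp_solutionI:
  assumes G: "continuous_on UNIV G"
    and u0: "u 0 = u0" and cont: "continuous_on {0..} u" and S: "finite S"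
    and d: "\<And>t. t > 0 \<Longrightarrow> t \<notin> S \<Longrightarrow> (u has_vector_derivative G (u t)) (at t)"
  shows "ivp_solution G u0 u"
proof -
  have Gu: "continuous_on {0..} (\<lambda>t. G (u t))"
    by (rule continuous_on_compose2[OF G cont]) auto
  have "(u has_vector_derivative G (u t)) (at t within {0..})" if t: "t \<ge> 0" for t
  proof -
    have int: "u s - u 0 = integral {0..s} (\<lambda>t. G (u t))" if "s \<ge> 0" for s
    proof (rule integral_unique[symmetric],
        rule fundamental_theorem_of_calculus_interior_strong[OF S that])
      show "continuous_on {0..s} u" using cont by (rule continuous_on_subset) auto
    qed (use d in auto)
    have "((\<lambda>s. integral {0..s} (\<lambda>t. G (u t))) has_vector_derivative G (u t)) (at t within {0..t + 1})"
      using t by (intro integral_has_vector_derivative continuous_on_subset[OF Gu]) auto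
    then have "((\<lambda>s. u 0 + integral {0..s} (\<lambda>t. G (u t))) has_vector_derivative G (u t))
        (at t within {0..t + 1})"
      by (rule has_vector_derivative_add[OF has_vector_derivative_const, THEN
            has_vector_derivative_eq_rhs]) simp
    then have "(u has_vector_derivative G (u t)) (at t within {0..t + 1})"
    proof (rule has_vector_derivative_transform[rotated 2])
      show "u s = u 0 + integral {0..s} (\<lambda>t. G (u t))" if "s \<in> {0..t + 1}" for s
        using int[of s] that by (simp add: diff_eq_eq add.commute)
    qed (use t in auto)
    moreover have "at t within {0..t + 1} = at t within {0..}"
      by (rule at_within_nhd[of _ "{..< t + 1}"]) auto
    ultimately show ?thesis by simp
  qed
  then show "ivp_solution G u0 u" using u0 by (simp add: ivp_solution_def)
qed

section \<open>Lyapunov estimate for rescaled coercive fields\<close>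

text \<open>
  The properties of the residual on which the dynamics depend, with \<open>p\<close> the equilibrium. Strong
  monotonicity enters only with respect to \<open>p\<close>.
\<close>

locale rescaled_flow =
  fixes R :: "real ^ 'n \<Rightarrow> real ^ 'n" and p :: "real ^ 'n" and K c a1 a2 r1 r2 :: real
  assumes R_lipschitz: "K-lipschitz_on UNIV R"
    and R_equilibrium: "R p = 0"
    and R_coercive: "\<And>u. c * (norm (u - p))\<^sup>2 \<le> R u \<bullet> (u - p)"
    and K_pos: "K > 0" and c_pos: "c > 0" and a1_pos: "a1 > 0" and a2_pos: "a2 > 0"
    and r1_pos: "0 < r1" and r1_less: "r1 < 1" and r2_gt: "r2 > 1"
begin

text \<open>
  The gain \<open>\<psi>\<close> as a function of the norm of the residual. Since \<open>0 powr x = 0\<close>, the value at \<open>0\<close> is \<open>0\<close>.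
\<close>

definition speed :: "real \<Rightarrow> real" where
  "speed y = a1 * y powr (r1 - 1) + a2 * y powr (r2 - 1)"

definition field :: "real ^ 'n \<Rightarrow> real ^ 'n" where
  "field u = - (speed (norm (R u)) *\<^sub>R R u)"

text \<open>
  The largest exponent for which both power terms of the gain can be used: the first one dominates
  near the equilibrium and the second one far away from it.
\<close>

definition \<kappa> :: real where "\<kappa> = min (1 - r1) (r2 - 1) / 2"

text \<open>
  The guaranteed speed of descent of the potential below along trajectories. The inner minimum pays
  for replacing the norm of the residual by the distance to the equilibrium, which agree up to the factors
  \<open>c\<close> and \<open>K\<close>.
\<close>

definition rate :: real where
  "rate = 2 * c * \<kappa> * (min a1 a2 / 2 * min (K powr (- 2 * \<kappa>)) (c powr (2 * \<kappa>)))"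

text \<open>
  With \<open>X = |u - p|\<^bsup>2\<kappa>\<^esup>\<close>, the arc tangent is a primitive of \<open>1 / (1 + X\<^sup>2)\<close>, the reciprocal of the growth of
  the gain times \<open>X\<close>. Its boundedness is what frees the bound on the settling time from the initial
  point.
\<close>

definition potential :: "real ^ 'n \<Rightarrow> real" where
  "potential u = arctan (((norm (u - p))\<^sup>2) powr \<kappa>)"

lemma \<kappa>_pos: "\<kappa> > 0"
  using r1_less r2_gt by (simp add: \<kappa>_def)

lemma rate_pos: "rate > 0"
  using \<kappa>_pos K_pos c_pos a1_pos a2_pos by (simp add: rate_def)

lemma norm_R_le: "norm (R u) \<le> K * norm (u - p)"
  using lipschitz_onD[OF R_lipschitz, of u p] by (simp add: R_equilibrium dist_norm)

lemma norm_R_ge: "c * norm (u - p) \<le> norm (R u)"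
proof (cases "u = p")
  case False
  have "(c * norm (u - p)) * norm (u - p) \<le> norm (R u) * norm (u - p)"
    using R_coercive[of u] norm_cauchy_schwarz[of "R u" "u - p"]
    by (simp add: power2_eq_square mult.assoc)
  then show ?thesis using False by simp
qed simp

lemma R_eq_0_iff: "R u = 0 \<longleftrightarrow> u = p"
  using norm_R_ge[of u] c_pos R_equilibrium by (auto simp: mult_le_0_iff)

lemma R_continuous: "continuous_on S R"
  using R_lipschitz lipschitz_on_continuous_on continuous_on_subset by blast

lemma speed_pos: "y > 0 \<Longrightarrow> speed y > 0"
  using a1_pos a2_pos by (simp add: speed_def add_pos_pos)

lemma speed_nonneg: "speed y \<ge> 0"
  using a1_pos a2_pos by (simp add: speed_def)

lemma speed_R_pos: "u \<noteq> p \<Longrightarrow> speed (norm (R u)) > 0"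
  by (simp add: speed_pos R_eq_0_iff)

lemma speed_R_continuous:
  assumes "continuous_on S x" "\<And>t. t \<in> S \<Longrightarrow> x t \<noteq> p"
  shows "continuous_on S (\<lambda>t. speed (norm (R (x t))))"
  unfolding speed_def using assms
  by (intro continuous_intros continuous_on_compose2[OF R_continuous[of UNIV] assms(1)])
     (auto simp: R_eq_0_iff)

lemma field_eq_0_iff: "field u = 0 \<longleftrightarrow> u = p"
  using speed_R_pos[of u] R_eq_0_iff[of u] by (auto simp: field_def)

text \<open>
  Away from the equilibrium the gain is continuous. At the equilibrium it blows up, but the field has norm
  \<open>a1 |R|\<^bsup>r1\<^esup> + a2 |R|\<^bsup>r2\<^esup>\<close> with positive exponents.
\<close>

lemma field_continuous: "continuous_on UNIV field"
  unfolding continuous_on_eq_continuous_at[OF open_UNIV]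
proof
  fix u
  have R: "(R \<longlongrightarrow> R u) (at u)"
    using R_continuous[of UNIV] by (auto simp: continuous_on_def)
  show "isCont field u"
  proof (cases "u = p")
    case False
    then have "norm (R u) \<noteq> 0" by (simp add: R_eq_0_iff)
    then show ?thesis
      unfolding isCont_def field_def speed_def by (intro tendsto_intros R) auto
  next
    case True
    have eq: "norm (field x) = a1 * norm (R x) powr r1 + a2 * norm (R x) powr r2" for x
    proof (cases "R x = 0")
      case False
      then have eq: "norm (R x) powr (r - 1) * norm (R x) = norm (R x) powr r" for r
        using powr_mult_base[of "norm (R x)" "r - 1"] by (simp add: mult.commute)
      have "norm (field x) = speed (norm (R x)) * norm (R x)"
        using speed_nonneg[of "norm (R x)"] by (simp add: field_def)
      also have "\<dots> = a1 * (norm (R x) powr (r1 - 1) * norm (R x))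
          + a2 * (norm (R x) powr (r2 - 1) * norm (R x))"
        by (simp add: speed_def distrib_right)
      finally show ?thesis unfolding eq .
    qed (simp add: field_def)
    have "((\<lambda>x. norm (field x)) \<longlongrightarrow> a1 * norm (R u) powr r1 + a2 * norm (R u) powr r2) (at u)"
      unfolding eq using r1_pos r2_gt
      by (intro tendsto_add tendsto_mult tendsto_const tendsto_powr' tendsto_norm R) auto
    then have "(field \<longlongrightarrow> 0) (at u)"
      using True R_equilibrium by (simp add: tendsto_norm_zero_iff)
    then show ?thesis
      using True by (simp add: isCont_def field_eq_0_iff[THEN iffD2])
  qed
qed

lemma norm_sq_derivative_along_R:
  assumes "(x has_vector_derivative - (\<rho> *\<^sub>R R (x t))) (at t)"
  shows "((\<lambda>t. (norm (x t - p))\<^sup>2) has_real_derivative - (2 * \<rho> * (R (x t) \<bullet> (x t - p)))) (at t)"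
  using norm_sq_has_derivative[OF assms, of p] by (simp add: mult.assoc)

text \<open>
  For \<open>y \<le> 1\<close> the power \<open>y powr (r1 - 1)\<close> alone dominates both terms on the right, and for \<open>y \<ge> 1\<close> the power
  \<open>y powr (r2 - 1)\<close> does; the factor \<open>1 / 2\<close> averages the two terms.
\<close>

lemma speed_ge:
  assumes "y > 0"
  shows "speed y \<ge> min a1 a2 / 2 * (y powr (- 2 * \<kappa>) + y powr (2 * \<kappa>))"
proof -
  have k: "2 * \<kappa> \<le> 1 - r1" "2 * \<kappa> \<le> r2 - 1" by (auto simp: \<kappa>_def)
  have *: "min a1 a2 / 2 * (X + Y) \<le> a * Z" if "X \<le> Z" "Y \<le> Z" "min a1 a2 \<le> a" "0 \<le> Z"
    for X Y Z a :: real
  proof -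
    have "min a1 a2 / 2 * (X + Y) \<le> min a1 a2 / 2 * (Z + Z)"
      using that a1_pos a2_pos by (intro mult_left_mono) auto
    also have "\<dots> \<le> a * Z" using that by (simp add: mult_right_mono)
    finally show ?thesis .
  qed
  show ?thesis
  proof (cases "y \<le> 1")
    case True
    have "y powr (- 2 * \<kappa>) \<le> y powr (r1 - 1)" "y powr (2 * \<kappa>) \<le> y powr (r1 - 1)"
      using True assms k \<kappa>_pos r1_less by (intro powr_mono'; linarith)+
    then have "min a1 a2 / 2 * (y powr (- 2 * \<kappa>) + y powr (2 * \<kappa>)) \<le> a1 * y powr (r1 - 1)"
      by (intro *) auto
    also have "\<dots> \<le> speed y" using a2_pos by (simp add: speed_def)
    finally show ?thesis .
  next
    case False
    have "y powr (- 2 * \<kappa>) \<le> y powr (r2 - 1)" "y powr (2 * \<kappa>) \<le> y powr (r2 - 1)"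
      using False assms k \<kappa>_pos r2_gt by (intro powr_mono; linarith)+
    then have "min a1 a2 / 2 * (y powr (- 2 * \<kappa>) + y powr (2 * \<kappa>)) \<le> a2 * y powr (r2 - 1)"
      by (intro *) auto
    also have "\<dots> \<le> speed y" using a1_pos by (simp add: speed_def)
    finally show ?thesis .
  qed
qed

text \<open>
  The gain estimate in terms of the distance to the equilibrium: up to constants, the gain is at
  least \<open>1 / X + X = (1 + X\<^sup>2) / X\<close>.
\<close>

lemma rate_le:
  fixes u defines "X \<equiv> ((norm (u - p))\<^sup>2) powr \<kappa>"
  assumes "u \<noteq> p"
  shows "rate * (1 + X\<^sup>2) \<le> 2 * c * \<kappa> * X * speed (norm (R u))"
proof -
  define n where "n = norm (u - p)"
  define y where "y = norm (R u)"
  define A where "A = min a1 a2 / 2"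
  define M where "M = min (K powr (- 2 * \<kappa>)) (c powr (2 * \<kappa>))"
  have n: "n > 0" and y: "y > 0" and A: "A > 0"
    using assms a1_pos a2_pos by (auto simp: n_def y_def A_def R_eq_0_iff)
  have X: "X = n powr (2 * \<kappa>)" "X > 0"
    using n by (simp_all add: X_def n_def[symmetric] powr_powr flip: powr_numeral)
  have inv: "1 / X = n powr (- 2 * \<kappa>)"
    by (simp add: X powr_minus inverse_eq_divide)
  have "M * (1 / X) \<le> K powr (- 2 * \<kappa>) * n powr (- 2 * \<kappa>)"
    unfolding inv by (intro mult_right_mono) (auto simp: M_def)
  also have "K powr (- 2 * \<kappa>) * n powr (- 2 * \<kappa>) = (K * n) powr (- 2 * \<kappa>)"
    using n K_pos by (simp add: powr_mult)
  also have "\<dots> \<le> y powr (- 2 * \<kappa>)"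
    using norm_R_le[of u] y \<kappa>_pos by (intro powr_mono2') (auto simp: n_def y_def)
  finally have lo: "M * (1 / X) \<le> y powr (- 2 * \<kappa>)" .
  have "M * X \<le> c powr (2 * \<kappa>) * n powr (2 * \<kappa>)"
    by (simp add: M_def X mult_right_mono)
  also have "\<dots> = (c * n) powr (2 * \<kappa>)" using n c_pos by (simp add: powr_mult)
  also have "\<dots> \<le> y powr (2 * \<kappa>)"
    using norm_R_ge[of u] n c_pos \<kappa>_pos by (intro powr_mono2) (auto simp: n_def y_def)
  finally have hi: "M * X \<le> y powr (2 * \<kappa>)" .
  have "A * (M * (1 / X) + M * X) \<le> A * (y powr (- 2 * \<kappa>) + y powr (2 * \<kappa>))"
    using lo hi A by (intro mult_left_mono add_mono) auto
  also have "\<dots> \<le> speed y" using speed_ge[OF y] by (simp add: A_def)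
  finally have "2 * c * \<kappa> * X * (A * (M * (1 / X) + M * X)) \<le> 2 * c * \<kappa> * X * speed y"
    using X c_pos \<kappa>_pos by (intro mult_left_mono) auto
  also have "2 * c * \<kappa> * X * (A * (M * (1 / X) + M * X)) = rate * (1 + X\<^sup>2)"
    using X unfolding rate_def A_def[symmetric] M_def[symmetric]
    by (simp add: field_simps power2_eq_square)
  finally show ?thesis by (simp add: y_def)
qed

text \<open>
  Stated for an arbitrary time scale \<open>\<rho>\<close>, because it is used twice: with the gain as \<open>\<rho>\<close> it bounds the
  settling time, and with \<open>\<rho> = 1\<close> it shows that the clock along an orbit of \<open>- R\<close> stays
  bounded.
\<close>

lemma potential_decreases:
  assumes x: "(x has_vector_derivative - (\<rho> *\<^sub>R R (x t))) (at t)"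
    and ne: "x t \<noteq> p" and \<rho>: "\<rho> \<ge> 0"
  obtains D where "((\<lambda>t. potential (x t)) has_real_derivative D) (at t)"
    and "D \<le> - rate * (\<rho> / speed (norm (R (x t))))"
proof -
  define E where "E = (norm (x t - p))\<^sup>2"
  define X where "X = E powr \<kappa>"
  define S where "S = speed (norm (R (x t)))"
  have E: "E > 0" using ne by (simp add: E_def)
  have X: "X > 0" using E by (simp add: X_def)
  have S: "S > 0" using ne by (simp add: S_def speed_R_pos)
  define D where "D = (1 / (1 + X\<^sup>2)) * (\<kappa> * E powr (\<kappa> - 1) * - (2 * \<rho> * (R (x t) \<bullet> (x t - p))))"
  have "((\<lambda>t. potential (x t)) has_real_derivative D) (at t)"
    unfolding potential_def D_def X_def E_def
    by (rule DERIV_chain2[OF has_real_derivative_powr norm_sq_derivative_along_R[OF x]]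
          derivative_eq_intros refl)+
       (use E in \<open>auto simp: E_def inverse_eq_divide\<close>)
  moreover have "D \<le> - rate * (\<rho> / S)"
  proof -
    have EX: "E powr (\<kappa> - 1) * E = X" using E by (simp add: X_def powr_diff)
    have "rate * (\<rho> / S) * (1 + X\<^sup>2) = (rate * (1 + X\<^sup>2)) * (\<rho> / S)" by simp
    also have "\<dots> \<le> (2 * c * \<kappa> * X * S) * (\<rho> / S)"
      using rate_le[OF ne] \<rho> S by (intro mult_right_mono) (auto simp: X_def E_def S_def)
    also have "\<dots> = \<kappa> * E powr (\<kappa> - 1) * (2 * \<rho> * (c * E))"
      using S by (simp add: EX[symmetric])
    also have "\<dots> \<le> \<kappa> * E powr (\<kappa> - 1) * (2 * \<rho> * (R (x t) \<bullet> (x t - p)))"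
      using R_coercive[of "x t"] \<kappa>_pos \<rho> by (intro mult_left_mono) (auto simp: E_def)
    finally have "rate * (\<rho> / S) \<le> - D"
      unfolding D_def by (simp add: pos_le_divide_eq add_pos_nonneg)
    then show ?thesis by simp
  qed
  ultimately show thesis using that by (simp add: S_def)
qed

lemma potential_continuous: "continuous_on S x \<Longrightarrow> continuous_on S (\<lambda>t. potential (x t))"
  unfolding potential_def using \<kappa>_pos by (intro continuous_intros continuous_on_powr') auto

lemma potential_range: "0 \<le> potential u" "potential u < pi / 2"
  using arctan_ubound by (auto simp: potential_def)

lemma field_solutionD:
  assumes "ivp_solution field u0 u"
  shows "u 0 = u0" "continuous_on {0..} u"
    "t > 0 \<Longrightarrow> (u has_vector_derivative - (speed (norm (R (u t))) *\<^sub>R R (u t))) (at t)"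
  using ivp_solutionD[OF assms] by (auto simp: field_def)

text \<open>
  Otherwise the potential would fall by \<open>\<pi> / 2\<close> before time \<open>T\<close>, but it takes its values in \<open>[0, \<pi> / 2)\<close>.
\<close>

lemma settling_time_le:
  assumes u: "ivp_solution field u0 u" and ne: "\<And>t. t \<in> {0..<T} \<Longrightarrow> u t \<noteq> p"
  shows "T \<le> pi / (2 * rate)"
proof (rule ccontr)
  assume T: "\<not> T \<le> pi / (2 * rate)"
  define b where "b = pi / (2 * rate)"
  have b: "0 \<le> b" "b < T" using T rate_pos by (auto simp: b_def)
  have "potential (u b) + rate * b \<le> potential (u 0) + rate * 0"
  proof (rule DERIV_nonpos_imp_decreasing_open[OF b(1)])
    fix t assume t: "0 < t" "t < b"
    have "u t \<noteq> p" using ne b t by auto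
    obtain D where D: "((\<lambda>t. potential (u t)) has_real_derivative D) (at t)"
      "D \<le> - rate * (speed (norm (R (u t))) / speed (norm (R (u t))))"
      by (rule potential_decreases[OF field_solutionD(3)[OF u t(1)] \<open>u t \<noteq> p\<close> speed_nonneg])
    have "((\<lambda>t. potential (u t) + rate * t) has_real_derivative D + rate) (at t)"
      by (rule derivative_eq_intros D refl)+ simp
    moreover have "D + rate \<le> 0" using D(2) speed_R_pos[OF \<open>u t \<noteq> p\<close>] by simp
    ultimately show "\<exists>y. ((\<lambda>t. potential (u t) + rate * t) has_real_derivative y) (at t) \<and> y \<le> 0"
      by blast
  next
    have "continuous_on {0..b} u"
      using field_solutionD(2)[OF u] by (rule continuous_on_subset) auto
    then show "continuous_on {0..b} (\<lambda>t. potential (u t) + rate * t)"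
      by (intro continuous_intros potential_continuous)
  qed
  moreover have "rate * b = pi / 2" using rate_pos by (simp add: b_def)
  ultimately show False using potential_range[of "u b"] potential_range[of "u 0"] by simp
qed

text \<open>
  Coercivity alone makes the distance to the equilibrium a Lyapunov function. This yields Lyapunov stability and
  prevents a trajectory from leaving the equilibrium, where uniqueness could otherwise fail because the
  field is not Lipschitz.
\<close>

lemma norm_nonincreasing:
  assumes u: "ivp_solution field u0 u" and ab: "0 \<le> a" "a \<le> b"
  shows "norm (u b - p) \<le> norm (u a - p)"
proof -
  have cont: "continuous_on {a..b} u"
    using field_solutionD(2)[OF u] by (rule continuous_on_subset) (use ab in auto)
  have "(norm (u b - p))\<^sup>2 \<le> (norm (u a - p))\<^sup>2"
  proof (rule DERIV_nonpos_imp_decreasing_open[OF ab(2)])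
    fix t assume t: "a < t" "t < b"
    let ?D = "- (2 * speed (norm (R (u t))) * (R (u t) \<bullet> (u t - p)))"
    have "0 \<le> R (u t) \<bullet> (u t - p)"
      by (rule order_trans[OF _ R_coercive]) (use c_pos in simp)
    then have "?D \<le> 0" using speed_nonneg by simp
    moreover have "((\<lambda>t. (norm (u t - p))\<^sup>2) has_real_derivative ?D) (at t)"
      using t ab by (intro norm_sq_derivative_along_R field_solutionD(3)[OF u]) auto
    ultimately show "\<exists>y. ((\<lambda>t. (norm (u t - p))\<^sup>2) has_real_derivative y) (at t) \<and> y \<le> 0"
      by blast
  qed (intro continuous_intros cont)
  then show ?thesis by simp
qed

lemma constant_solution: "ivp_solution field p (\<lambda>_. p)"
  by (simp add: ivp_solution_def field_eq_0_iff[THEN iffD2])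

lemma solution_stays_at_equilibrium:
  assumes "ivp_solution field u0 u" "0 \<le> a" "u a = p" "a \<le> t"
  shows "u t = p"
  using norm_nonincreasing[OF assms(1,2,4)] assms(3) by simp

end

section \<open>Time change along the orbits of the unscaled field\<close>

text \<open>
  A solution \<open>v\<close> of \<open>v' = - R v\<close> together with its clock: \<open>h s\<close> is the time at which the rescaled motion
  passes through \<open>v s\<close>, and \<open>T\<close> is the finite limit of \<open>h\<close>. The clock is continued linearly to
  negative arguments, by freezing \<open>v\<close> at \<open>v 0\<close>, so that its inverse is differentiable on both
  sides of time \<open>0\<close>.
\<close>

locale reparametrized_orbit = rescaled_flow R p K c a1 a2 r1 r2
  for R :: "real ^ 'n \<Rightarrow> real ^ 'n" and p K c a1 a2 r1 r2 +
  fixes v :: "real \<Rightarrow> real ^ 'n" and h :: "real \<Rightarrow> real" and T :: real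
  assumes v_continuous: "continuous_on UNIV v"
    and v_derivative: "\<And>s. s \<ge> 0 \<Longrightarrow> (v has_vector_derivative - R (v s)) (at s)"
    and v_ne: "\<And>s. s \<ge> 0 \<Longrightarrow> v s \<noteq> p"
    and v_tendsto: "(v \<longlongrightarrow> p) at_top"
    and h_0: "h 0 = 0"
    and h_derivative: "\<And>s. (h has_real_derivative 1 / speed (norm (R (v (max 0 s))))) (at s)"
    and h_less: "\<And>s. h s < T"
    and h_onto: "\<And>t. 0 \<le> t \<Longrightarrow> t < T \<Longrightarrow> \<exists>s\<ge>0. h s = t"
begin

definition trajectory :: "real \<Rightarrow> real ^ 'n" where
  "trajectory t = (if t < T then v (max 0 (inv h t)) else p)"

lemma T_pos: "T > 0"
  using h_less[of 0] by (simp add: h_0)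

lemma h_strict_mono: "strict_mono h"
proof (rule strict_monoI)
  fix a b :: real assume "a < b"
  then show "h a < h b"
  proof (rule DERIV_pos_imp_increasing)
    fix s
    show "\<exists>y. (h has_real_derivative y) (at s) \<and> 0 < y"
      by (intro exI conjI, rule h_derivative) (simp add: speed_R_pos v_ne)
  qed
qed

lemma inv_h [simp]: "inv h (h s) = s"
  by (rule inv_f_f[OF strict_mono_imp_inj_on[OF h_strict_mono]])

lemma h_continuous: "continuous_on S h"
  by (rule DERIV_continuous_on[OF DERIV_subset[OF h_derivative]]) auto

lemma inv_h_isCont: "isCont (inv h) (h s)"
  by (rule isCont_inverse_function[of 1])
     (use h_continuous[of UNIV] in \<open>auto simp: continuous_on_eq_continuous_at\<close>)

lemma inv_h_derivative:
  "(inv h has_real_derivative speed (norm (R (v (max 0 s))))) (at (h s))"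
proof -
  have "(inv h has_real_derivative inverse (1 / speed (norm (R (v (max 0 s)))))) (at (h s))"
  proof (rule DERIV_inverse_function[where f = h])
    show "(h has_real_derivative 1 / speed (norm (R (v (max 0 s))))) (at (inv h (h s)))"
      by (simp add: h_derivative)
    show "1 / speed (norm (R (v (max 0 s)))) \<noteq> 0"
      using speed_R_pos[OF v_ne[of "max 0 s"]] by simp
    show "h (s - 1) < h s" "h s < h (s + 1)"
      by (auto intro: strict_monoD[OF h_strict_mono])
    show "h (inv h y) = y" if y: "h (s - 1) < y" "y < h (s + 1)" for y
    proof -
      have "\<exists>r\<ge>s - 1. r \<le> s + 1 \<and> h r = y"
        by (rule IVT') (use y h_continuous in auto)
      then show ?thesis by auto
    qed
  qed (rule inv_h_isCont)
  then show ?thesis by simp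
qed

lemma trajectory_h: "s \<ge> 0 \<Longrightarrow> trajectory (h s) = v s"
  by (simp add: trajectory_def h_less)

lemma trajectory_after: "t \<ge> T \<Longrightarrow> trajectory t = p"
  by (simp add: trajectory_def)

lemma trajectory_0: "trajectory 0 = v 0"
  using trajectory_h[of 0] by (simp add: h_0)

lemma trajectory_ne: "0 \<le> t \<Longrightarrow> t < T \<Longrightarrow> trajectory t \<noteq> p"
  using h_onto[of t] trajectory_h v_ne by metis

text \<open>
  Before \<open>T\<close> this is continuity of the inverse clock. At \<open>T\<close> the inverse clock tends to infinity, where
  \<open>v\<close> tends to the equilibrium.
\<close>

lemma trajectory_isCont:
  assumes "t \<ge> 0"
  shows "isCont trajectory t"
proof -
  consider "t < T" | "t = T" | "t > T" by linarith
  then show ?thesis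
  proof cases
    case 1
    then obtain s where s: "h s = t" using h_onto assms by blast
    have v: "isCont v r" for r
      using v_continuous by (simp add: continuous_on_eq_continuous_at)
    have "isCont (\<lambda>t. max 0 (inv h t)) t"
      using inv_h_isCont[of s] s by (intro continuous_intros) simp
    then have "isCont (\<lambda>t. v (max 0 (inv h t))) t"
      by (rule isCont_o2) (rule v)
    moreover have "\<forall>\<^sub>F x in nhds t. v (max 0 (inv h x)) = trajectory x"
      using eventually_nhds_in_open[of "{..<T}" t] 1
      by (auto simp: trajectory_def elim: eventually_mono)
    ultimately show ?thesis by (rule isCont_cong[THEN iffD1, rotated])
  next
    case 2
    show ?thesis
      unfolding isCont_def tendsto_iff 2
    proof (intro allI impI)
      fix e :: real assume e: "e > 0"
      then have "\<forall>\<^sub>F s in at_top. dist (v s) p < e"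
        using v_tendsto by (simp add: tendsto_iff)
      then obtain S where S: "\<And>s. s \<ge> S \<Longrightarrow> dist (v s) p < e"
        by (auto simp: eventually_at_top_linorder)
      have "dist (trajectory x) p < e" if x: "x > h (max 0 S)" for x
      proof (cases "x < T")
        case True
        have "h 0 \<le> h (max 0 S)"
          by (rule monoD[OF strict_mono_mono[OF h_strict_mono]]) simp
        then have "0 \<le> x" using x by (simp add: h_0)
        then obtain s where s: "s \<ge> 0" "h s = x" using h_onto True by blast
        then have "s > max 0 S" using x strict_mono_less[OF h_strict_mono] by blast
        then show ?thesis using s S[of s] trajectory_h[of s] by simp
      qed (use e in \<open>simp add: trajectory_after\<close>)
      moreover have "\<forall>\<^sub>F x in at T. x \<in> {h (max 0 S)<..}"
        by (rule eventually_at_in_open') (use h_less in auto)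
      ultimately show "\<forall>\<^sub>F x in at T. dist (trajectory x) (trajectory T) < e"
        by (auto simp: trajectory_after elim: eventually_mono)
    qed
  next
    case 3
    have "\<forall>\<^sub>F x in nhds t. p = trajectory x"
      using eventually_nhds_in_open[of "{T<..}" t] 3
      by (auto simp: trajectory_def elim: eventually_mono)
    then show ?thesis by (rule isCont_cong[THEN iffD1]) (rule continuous_const)
  qed
qed

lemma trajectory_solution: "ivp_solution field (v 0) trajectory"
proof (rule ivp_solutionI[where S = "{T}"])
  show "continuous_on {0..} trajectory"
    using trajectory_isCont by (auto intro!: continuous_at_imp_continuous_on)
  show "continuous_on UNIV field" "trajectory 0 = v 0" "finite {T}"
    by (simp_all add: field_continuous trajectory_0)
  fix t assume t: "t > 0" "t \<notin> {T}"
  show "(trajectory has_vector_derivative field (trajectory t)) (at t)"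
  proof (cases "t < T")
    case True
    then obtain s where s: "s \<ge> 0" "h s = t" using h_onto[of t] t by auto
    have nonneg: "inv h r \<ge> 0" if "r \<in> {0<..<T}" for r
      using h_onto[of r] that by auto
    have "(inv h has_vector_derivative speed (norm (R (v s)))) (at t)"
      using inv_h_derivative[of s] s by (simp add: has_real_derivative_iff_has_vector_derivative max_def)
    moreover have "(v has_vector_derivative - R (v s)) (at (inv h t))"
      using v_derivative[of s] s by auto
    ultimately have "((v \<circ> inv h) has_vector_derivative speed (norm (R (v s))) *\<^sub>R (- R (v s))) (at t)"
      by (rule vector_diff_chain_at)
    then have "(trajectory has_vector_derivative speed (norm (R (v s))) *\<^sub>R (- R (v s))) (at t)"
      by (rule has_vector_derivative_transform_within_open[where S = "{0<..<T}"])
         (use t True nonneg in \<open>auto simp: trajectory_def max_def\<close>)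
    then show ?thesis using s trajectory_h[of s] by (simp add: field_def)
  next
    case False
    have "((\<lambda>_. p) has_vector_derivative 0) (at t)" by simp
    then have "(trajectory has_vector_derivative 0) (at t)"
      by (rule has_vector_derivative_transform_within_open[where S = "{T<..}"])
         (use t False in \<open>auto simp: trajectory_def\<close>)
    then show ?thesis using False by (simp add: trajectory_after field_eq_0_iff[THEN iffD2])
  qed
qed

text \<open>
  Measure time along \<open>w\<close> by \<open>\<sigma>\<close> with \<open>\<sigma>' = \<psi>(|R w|)\<close>. Then \<open>w\<close> and \<open>v \<circ> \<sigma>\<close> both solve the
  rescaled equation \<open>x' = - \<sigma>' R x\<close>, which is Lipschitz in \<open>x\<close>, and hence agree. Knowing this, \<open>\<sigma>'\<close> is the
  reciprocal of \<open>h' \<circ> \<sigma>\<close>, so \<open>\<sigma>\<close> is the inverse of the clock.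
\<close>

lemma solution_eq_trajectory_before_equilibrium:
  assumes w: "ivp_solution field (v 0) w" and b: "b \<ge> 0"
    and ne: "\<And>t. t \<in> {0..b} \<Longrightarrow> w t \<noteq> p"
  shows "w b = trajectory b"
proof (cases "b = 0")
  case True
  then show ?thesis using field_solutionD(1)[OF w] by (simp add: trajectory_0)
next
  case False
  then have b: "b > 0" using b by simp
  have w_cont: "continuous_on {0..t} w" for t
    using field_solutionD(2)[OF w] by (rule continuous_on_subset) auto
  \<comment> \<open>The argument is clamped to \<open>{0..b}\<close>, where \<open>w\<close> avoids the equilibrium, to get a function that is
      continuous and positive on the whole real line.\<close>
  define q where "q t = speed (norm (R (w (max 0 (min t b)))))" for t
  have q_pos: "q t > 0" for t
    unfolding q_def using b by (intro speed_R_pos ne) auto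
  have q_eq: "q t = speed (norm (R (w t)))" if "0 < t" "t < b" for t
    using that by (simp add: q_def)
  have "continuous_on UNIV q"
    unfolding q_def
    by (intro speed_R_continuous ne continuous_on_compose2[OF w_cont[of b]] continuous_intros)
       (use b in auto)
  then obtain \<sigma> where \<sigma>0: "\<sigma> 0 = 0" and \<sigma>: "\<And>t. (\<sigma> has_vector_derivative q t) (at t)"
    using antiderivative_on_reals by blast
  have \<sigma>': "(\<sigma> has_real_derivative q t) (at t)" for t
    by (simp add: has_real_derivative_iff_has_vector_derivative \<sigma>)
  have \<sigma>_cont: "continuous_on S \<sigma>" for S
    by (rule DERIV_continuous_on[OF DERIV_subset[OF \<sigma>']]) auto
  have \<sigma>_nonneg: "\<sigma> t \<ge> 0" if "t \<ge> 0" for t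
    using DERIV_nonneg_imp_nondecreasing[OF that, of \<sigma>] \<sigma>' less_imp_le[OF q_pos] \<sigma>0
    by auto
  have v\<sigma>_cont: "continuous_on S (\<lambda>t. v (\<sigma> t))" for S
    by (rule continuous_on_compose2[OF v_continuous \<sigma>_cont]) auto
  have wv: "w t = v (\<sigma> t)" if t: "0 \<le> t" "t \<le> b" for t
  proof -
    have "(norm (w t - v (\<sigma> t) - 0))\<^sup>2
        \<le> (norm (w 0 - v (\<sigma> 0) - 0))\<^sup>2 * exp (2 * K * \<sigma> t - 2 * K * \<sigma> 0)"
    proof (rule gronwall_differential[OF t(1)])
      fix r assume r: "0 < r" "r < t"
      then have r': "0 < r" "r < b" using t by auto
      let ?d = "R (w r) - R (v (\<sigma> r))"
      have "((v \<circ> \<sigma>) has_vector_derivative q r *\<^sub>R - R (v (\<sigma> r))) (at r)"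
        by (rule vector_diff_chain_at[OF \<sigma> v_derivative[OF \<sigma>_nonneg]]) (use r in simp)
      then have "((\<lambda>r. w r - v (\<sigma> r)) has_vector_derivative
          - (q r *\<^sub>R R (w r)) - q r *\<^sub>R - R (v (\<sigma> r))) (at r)"
        using field_solutionD(3)[OF w r(1)] q_eq[OF r']
        by (intro has_vector_derivative_diff) (auto simp: o_def)
      moreover have "- (q r *\<^sub>R R (w r)) - q r *\<^sub>R - R (v (\<sigma> r)) = - (q r *\<^sub>R ?d)"
        by (simp add: algebra_simps)
      ultimately show "((\<lambda>r. (norm (w r - v (\<sigma> r) - 0))\<^sup>2) has_real_derivative
          2 * (- (q r *\<^sub>R ?d) \<bullet> (w r - v (\<sigma> r) - 0))) (at r)"
        by (intro norm_sq_has_derivative) simp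
      show "((\<lambda>r. 2 * K * \<sigma> r) has_real_derivative 2 * K * q r) (at r)"
        by (rule derivative_eq_intros \<sigma>' refl)+ simp
      have "- (?d \<bullet> (w r - v (\<sigma> r))) \<le> norm ?d * norm (w r - v (\<sigma> r))"
        using Cauchy_Schwarz_ineq2[of ?d "w r - v (\<sigma> r)"] by linarith
      also have "\<dots> \<le> K * norm (w r - v (\<sigma> r)) * norm (w r - v (\<sigma> r))"
        using lipschitz_onD[OF R_lipschitz, of "w r" "v (\<sigma> r)"]
        by (intro mult_right_mono) (auto simp: dist_norm)
      finally have "2 * q r * - (?d \<bullet> (w r - v (\<sigma> r))) \<le> 2 * q r * (K * (norm (w r - v (\<sigma> r)))\<^sup>2)"
        using q_pos[of r] by (intro mult_left_mono) (auto simp: power2_eq_square mult.assoc)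
      then show "2 * (- (q r *\<^sub>R ?d) \<bullet> (w r - v (\<sigma> r) - 0))
          \<le> 2 * K * q r * (norm (w r - v (\<sigma> r) - 0))\<^sup>2"
        by (simp add: algebra_simps)
    qed (intro continuous_intros w_cont v\<sigma>_cont \<sigma>_cont)+
    then show ?thesis using field_solutionD(1)[OF w] \<sigma>0 by simp
  qed
  have "h (\<sigma> b) - b = h (\<sigma> 0) - 0"
  proof (rule DERIV_isconst_end[OF b])
    show "continuous_on {0..b} (\<lambda>t. h (\<sigma> t) - t)"
      by (intro continuous_intros continuous_on_compose2[OF h_continuous[of UNIV] \<sigma>_cont]) auto
    fix t assume t: "0 < t" "t < b"
    have "((\<lambda>t. h (\<sigma> t)) has_real_derivative 1 / speed (norm (R (v (max 0 (\<sigma> t))))) * q t) (at t)"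
      by (rule DERIV_chain2[OF h_derivative \<sigma>'])
    moreover have "1 / speed (norm (R (v (max 0 (\<sigma> t))))) * q t = 1"
      using t wv[of t] q_eq[OF t] q_pos[of t] \<sigma>_nonneg[of t] by (simp add: max_def)
    ultimately have "((\<lambda>t. h (\<sigma> t)) has_real_derivative 1) (at t)" by simp
    then show "((\<lambda>t. h (\<sigma> t) - t) has_real_derivative 0) (at t)"
      by (rule DERIV_diff[OF _ DERIV_ident, THEN DERIV_cong]) simp
  qed
  then have "h (\<sigma> b) = b" by (simp add: \<sigma>0 h_0)
  then show ?thesis
    using wv[of b] b trajectory_h[OF \<sigma>_nonneg[of b]] by simp
qed

text \<open>
  A solution cannot meet the equilibrium before \<open>T\<close>: up to the first such time it equals the trajectory,
  and so by continuity it also does at that time, where the trajectory is elsewhere. At \<open>T\<close> it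
  arrives at the equilibrium by continuity, and it stays there.
\<close>

lemma solution_unique:
  assumes w: "ivp_solution field (v 0) w" and t: "t \<ge> 0"
  shows "w t = trajectory t"
proof -
  have limit: "w a = trajectory a"
    if a: "a > 0" and eq: "\<And>s. 0 \<le> s \<Longrightarrow> s < a \<Longrightarrow> w s = trajectory s" for a
  proof -
    have "isCont w a"
      using continuous_on_interior[OF field_solutionD(2)[OF w]] a by simp
    then have "(w \<longlongrightarrow> w a) (at_left a)"
      by (auto simp: isCont_def intro: tendsto_within_subset)
    moreover have "(trajectory \<longlongrightarrow> trajectory a) (at_left a)"
      using trajectory_isCont[of a] a by (auto simp: isCont_def intro: tendsto_within_subset)
    moreover have "\<forall>\<^sub>F s in at_left a. w s = trajectory s"
      using eventually_at_left_real[OF a] by eventually_elim (use eq in auto)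
    ultimately have "(trajectory \<longlongrightarrow> w a) (at_left a)"
      using tendsto_cong[of w trajectory "at_left a"] by simp
    then show ?thesis
      by (rule tendsto_unique[OF trivial_limit_at_left_real]) fact
  qed
  have before: "w s = trajectory s" if s: "0 \<le> s" "s < T" for s
  proof (rule solution_eq_trajectory_before_equilibrium[OF w s(1)])
    show "w r \<noteq> p" if r: "r \<in> {0..s}" for r
    proof
      assume "w r = p"
      define Z where "Z = {r \<in> {0..s}. w r = p}"
      have "continuous_on {0..s} w"
        using field_solutionD(2)[OF w] by (rule continuous_on_subset) auto
      then have "closed Z"
        unfolding Z_def by (intro continuous_closed_preimage_constant) auto
      then have "compact Z"
        by (auto simp: compact_eq_bounded_closed Z_def intro: bounded_subset[OF bounded_closed_interval])
      moreover have "Z \<noteq> {}" using \<open>w r = p\<close> r by (auto simp: Z_def)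
      ultimately obtain z where z: "z \<in> Z" and first: "\<And>x. x \<in> Z \<Longrightarrow> z \<le> x"
        using compact_attains_inf[of Z] by auto
      have "z \<noteq> 0" using z field_solutionD(1)[OF w] v_ne[of 0] by (auto simp: Z_def)
      then have z0: "z > 0" "z \<le> s" "w z = p" using z by (auto simp: Z_def)
      have "w x = trajectory x" if x: "0 \<le> x" "x < z" for x
      proof (rule solution_eq_trajectory_before_equilibrium[OF w x(1)])
        show "w y \<noteq> p" if "y \<in> {0..x}" for y
          using first[of y] z0 x that by (auto simp: Z_def)
      qed
      then have "w z = trajectory z" by (rule limit[OF z0(1)])
      then show False using trajectory_ne[of z] z0 s by simp
    qed
  qed
  show ?thesis
  proof (cases "t < T")
    case False
    have "w T = p" using limit[OF T_pos before] by (simp add: trajectory_after)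
    then show ?thesis
      using solution_stays_at_equilibrium[OF w less_imp_le[OF T_pos]] False
      by (simp add: trajectory_after)
  qed (use before t in simp)
qed

end

section \<open>Fixed-time stability of the rescaled flow\<close>

context rescaled_flow
begin

text \<open>
  Along a solution \<open>v\<close> of \<open>v' = - R v\<close> the squared distance to the equilibrium is squeezed between two
  exponentials: the Lipschitz bound keeps \<open>v\<close> off the equilibrium, and coercivity drives it there. The
  clock stays bounded because the bounded potential falls along \<open>v\<close> at least \<open>rate\<close> times as fast as
  the clock advances.
\<close>

lemma reparametrized_orbit_exists:
  assumes "u0 \<noteq> p"
  obtains v h T where "reparametrized_orbit R p K c a1 a2 r1 r2 v h T" "v 0 = u0"
proof -
  have "K-lipschitz_on UNIV (\<lambda>u. - R u)"
    using R_lipschitz by (simp add: lipschitz_on_def dist_minus)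
  then obtain v where v0: "v 0 = u0" and v: "continuous_on UNIV v"
    and dv: "\<And>t. t \<ge> 0 \<Longrightarrow> (v has_vector_derivative - R (v t)) (at t)"
    using lipschitz_ivp_exists[of K "\<lambda>u. - R u" u0] by auto
  define E where "E = (\<lambda>t. (norm (v t - p))\<^sup>2)"
  have E_cont: "continuous_on S E" for S
    unfolding E_def by (intro continuous_intros continuous_on_subset[OF v]) auto
  have dv': "(v has_vector_derivative - (1 *\<^sub>R R (v t))) (at t)" if "t \<ge> 0" for t
    using dv[OF that] by simp
  have dE: "(E has_real_derivative - (2 * (R (v t) \<bullet> (v t - p)))) (at t)" if "t \<ge> 0" for t
    using norm_sq_derivative_along_R[OF dv'[OF that]] by (simp add: E_def)
  have E0: "E 0 > 0" using assms by (simp add: E_def v0)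
  have lower: "E 0 * exp (- (2 * K * s)) \<le> E s" if s: "s \<ge> 0" for s
  proof -
    have "- E s \<le> - E 0 * exp (- (2 * K) * s - - (2 * K) * 0)"
    proof (rule gronwall_differential[OF s])
      fix t assume t: "0 < t" "t < s"
      show "((\<lambda>t. - E t) has_real_derivative 2 * (R (v t) \<bullet> (v t - p))) (at t)"
        by (rule derivative_eq_intros dE refl)+ (use t in auto)
      show "((\<lambda>t. - (2 * K) * t) has_real_derivative - (2 * K)) (at t)"
        by (rule derivative_eq_intros refl)+ simp
      have "R (v t) \<bullet> (v t - p) \<le> norm (R (v t)) * norm (v t - p)"
        by (rule norm_cauchy_schwarz)
      also have "\<dots> \<le> K * norm (v t - p) * norm (v t - p)"
        by (intro mult_right_mono norm_R_le) simp
      finally show "2 * (R (v t) \<bullet> (v t - p)) \<le> - (2 * K) * - E t"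
        by (simp add: E_def power2_eq_square)
    qed (intro continuous_intros E_cont)+
    then show ?thesis by simp
  qed
  have v_ne: "v s \<noteq> p" if "s \<ge> 0" for s
  proof -
    have "0 < E 0 * exp (- (2 * K * s))" using E0 by simp
    then have "E s > 0" using lower[OF that] by linarith
    then show ?thesis by (auto simp: E_def)
  qed
  have upper: "E s \<le> E 0 * exp (- (2 * c) * s)" if s: "s \<ge> 0" for s
  proof -
    have "E s \<le> E 0 * exp (- (2 * c) * s - - (2 * c) * 0)"
    proof (rule gronwall_differential[OF s])
      fix t assume t: "0 < t" "t < s"
      show "(E has_real_derivative - (2 * (R (v t) \<bullet> (v t - p)))) (at t)"
        using dE t by simp
      show "((\<lambda>t. - (2 * c) * t) has_real_derivative - (2 * c)) (at t)"
        by (rule derivative_eq_intros refl)+ simp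
      show "- (2 * (R (v t) \<bullet> (v t - p))) \<le> - (2 * c) * E t"
        using R_coercive[of "v t"] by (simp add: E_def)
    qed (intro continuous_intros E_cont)+
    then show ?thesis by simp
  qed
  have v_lim: "(v \<longlongrightarrow> p) at_top"
  proof -
    have "filterlim (\<lambda>s. - (2 * c) * s) at_bot at_top"
      using c_pos by (intro filterlim_tendsto_neg_mult_at_bot[OF tendsto_const _ filterlim_ident]) simp
    then have "((\<lambda>s. exp (- (2 * c) * s)) \<longlongrightarrow> 0) at_top"
      by (rule filterlim_compose[OF exp_at_bot])
    then have lim: "((\<lambda>s. E 0 * exp (- (2 * c) * s)) \<longlongrightarrow> 0) at_top"
      by (rule tendsto_mult_right_zero)
    have "(E \<longlongrightarrow> 0) at_top"
    proof (rule tendsto_sandwich[OF _ _ tendsto_const lim])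
      show "\<forall>\<^sub>F s in at_top. E s \<le> E 0 * exp (- (2 * c) * s)"
        by (rule eventually_at_top_linorderI[of 0]) (rule upper)
    qed (simp add: E_def)
    then have "((\<lambda>s. sqrt (E s)) \<longlongrightarrow> sqrt 0) at_top"
      by (rule tendsto_real_sqrt)
    then have "((\<lambda>s. v s - p) \<longlongrightarrow> 0) at_top"
      by (simp add: E_def tendsto_norm_zero_iff)
    then show ?thesis by (rule LIM_zero_cancel)
  qed
  define q where "q s = 1 / speed (norm (R (v (max 0 s))))" for s
  have q_pos: "q s > 0" for s
    by (simp add: q_def speed_R_pos v_ne)
  have "continuous_on UNIV (\<lambda>s. speed (norm (R (v (max 0 s)))))"
    by (intro speed_R_continuous continuous_on_compose2[OF v] continuous_intros) (auto simp: v_ne)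
  then have "continuous_on UNIV q"
    unfolding q_def by (rule continuous_on_divide[OF continuous_on_const])
      (use speed_R_pos v_ne in \<open>auto simp: less_imp_neq[symmetric]\<close>)
  then obtain h where h0: "h 0 = 0" and h: "\<And>s. (h has_vector_derivative q s) (at s)"
    using antiderivative_on_reals[of q] by auto
  have h': "(h has_real_derivative q s) (at s)" for s
    by (simp add: has_real_derivative_iff_has_vector_derivative h)
  have h_cont: "continuous_on S h" for S
    by (rule DERIV_continuous_on[OF DERIV_subset[OF h']]) auto
  have h_less: "h a < h b" if "a < b" for a b
    by (rule DERIV_pos_imp_increasing[OF that]) (use h' q_pos in auto)
  have h_bound: "h s \<le> pi / 2 / rate" for s
  proof -
    have *: "h s \<le> pi / 2 / rate" if s: "s \<ge> 0" for s
    proof -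
      have "potential (v s) + rate * h s \<le> potential (v 0) + rate * h 0"
      proof (rule DERIV_nonpos_imp_decreasing_open[OF s])
        fix t assume t: "0 < t" "t < s"
        obtain D where D: "((\<lambda>t. potential (v t)) has_real_derivative D) (at t)"
          "D \<le> - rate * (1 / speed (norm (R (v t))))"
          by (rule potential_decreases[OF dv'[of t]]) (use t v_ne in auto)
        have "((\<lambda>t. potential (v t) + rate * h t) has_real_derivative D + rate * q t) (at t)"
          by (rule derivative_eq_intros D h' refl)+ simp
        moreover have "D + rate * q t \<le> 0" using D(2) t by (simp add: q_def max_def)
        ultimately show "\<exists>y. ((\<lambda>t. potential (v t) + rate * h t) has_real_derivative y) (at t) \<and> y \<le> 0"
          by blast
      qed (intro continuous_intros potential_continuous h_cont continuous_on_subset[OF v], auto)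
      then have "rate * h s \<le> pi / 2"
        using potential_range[of "v s"] potential_range[of "v 0"] by (simp add: h0)
      then show ?thesis using rate_pos by (simp add: pos_le_divide_eq mult.commute)
    qed
    show ?thesis
    proof (cases "s \<ge> 0")
      case False
      then have "h s < h 0" by (intro h_less) simp
      then show ?thesis using *[of 0] by simp
    qed (rule *)
  qed
  define T where "T = Sup (range h)"
  have bdd: "bdd_above (range h)" by (rule bdd_aboveI2) (rule h_bound)
  have "reparametrized_orbit R p K c a1 a2 r1 r2 v h T"
  proof
    show "h s < T" for s
      using h_less[of s "s + 1"] cSup_upper[OF rangeI bdd, of "s + 1"] by (simp add: T_def)
    show "\<exists>s\<ge>0. h s = t" if t: "0 \<le> t" "t < T" for t
    proof -
      obtain s1 where s1: "t < h s1"
        using t(2) less_cSup_iff[OF _ bdd] by (auto simp: T_def)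
      have "0 \<le> s1"
      proof (rule ccontr)
        assume "\<not> 0 \<le> s1"
        then have "h s1 < h 0" by (intro h_less) simp
        then show False using s1 t h0 by simp
      qed
      then have "\<exists>s\<ge>0. s \<le> s1 \<and> h s = t"
        by (intro IVT') (use s1 t h0 h_cont in auto)
      then show ?thesis by blast
    qed
    show "(h has_real_derivative 1 / speed (norm (R (v (max 0 s))))) (at s)" for s
      using h'[of s] by (simp add: q_def)
  qed (fact v dv v_ne v_lim h0)+
  then show thesis using v0 that by blast
qed

lemma trajectory_exists:
  assumes "u0 \<noteq> p"
  shows "\<exists>T>0. \<exists>u. the_ivp_solution field u0 u \<and> (\<forall>t\<in>{0..<T}. u t \<noteq> p) \<and> (u \<longlongrightarrow> p) (at T)"
proof -
  obtain v h T where o: "reparametrized_orbit R p K c a1 a2 r1 r2 v h T" and v0: "v 0 = u0"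
    using reparametrized_orbit_exists[OF assms] by blast
  interpret reparametrized_orbit R p K c a1 a2 r1 r2 v h T by (rule o)
  have "the_ivp_solution field u0 trajectory"
    unfolding the_ivp_solution_def
    using trajectory_solution solution_unique by (auto simp: v0)
  moreover have "(trajectory \<longlongrightarrow> p) (at T)"
    using trajectory_isCont[of T] T_pos by (simp add: isCont_def trajectory_after)
  ultimately show ?thesis
    using T_pos trajectory_ne by (intro exI[of _ T] conjI exI[of _ trajectory] ballI) auto
qed

lemma the_solution_exists: "\<exists>u. the_ivp_solution field u0 u"
proof (cases "u0 = p")
  case True
  have "the_ivp_solution field p (\<lambda>_. p)"
    unfolding the_ivp_solution_def
  proof (intro conjI allI impI constant_solution)
    fix w and t :: real assume w: "ivp_solution field p w" and t: "0 \<le> t"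
    show "w t = p"
      by (rule solution_stays_at_equilibrium[OF w order_refl field_solutionD(1)[OF w] t])
  qed
  then show ?thesis using True by blast
qed (use trajectory_exists in blast)

text \<open>
  Balls around the equilibrium are invariant, so \<open>\<delta> = \<epsilon>\<close> works.
\<close>

lemma field_lyapunov_stable: "lyapunov_stable field p"
  unfolding lyapunov_stable_def
proof (intro allI impI)
  fix e :: real assume e: "e > 0"
  have "\<exists>u. the_ivp_solution field u0 u \<and> (\<forall>t>0. u t \<in> ball p e)" if u0: "u0 \<in> ball p e" for u0
  proof -
    obtain u where u: "the_ivp_solution field u0 u" using the_solution_exists by blast
    then have u': "ivp_solution field u0 u" by (simp add: the_ivp_solution_def)
    have "u t \<in> ball p e" if "t > 0" for t
      using norm_nonincreasing[OF u', of 0 t] that u0 field_solutionD(1)[OF u']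
      by (simp add: dist_norm norm_minus_commute)
    then show ?thesis using u by blast
  qed
  then show "\<exists>d>0. \<forall>u0\<in>ball p d. \<exists>u. the_ivp_solution field u0 u \<and> (\<forall>t>0. u t \<in> ball p e)"
    using e by blast
qed

lemma settling_time_function_le:
  assumes "settling_time_function field p T" "u0 \<noteq> p"
  shows "T u0 \<le> pi / (2 * rate)"
proof -
  obtain u where "the_ivp_solution field u0 u" "\<forall>t\<in>{0..<T u0}. u t \<noteq> p"
    using assms unfolding settling_time_function_def by blast
  then show ?thesis
    by (intro settling_time_le[of u0 u]) (auto simp: the_ivp_solution_def)
qed

theorem field_globally_fixed_time_stable: "globally_fixed_time_stable field p"
proof -
  have "\<exists>T. \<forall>u0. u0 \<noteq> p \<longrightarrow> T u0 > 0 \<and> (\<exists>u. the_ivp_solution field u0 u \<and>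
      (\<forall>t\<in>{0..<T u0}. u t \<noteq> p) \<and> (u \<longlongrightarrow> p) (at (T u0)))"
    using trajectory_exists by (intro choice) blast
  then obtain T where T: "settling_time_function field p T"
    unfolding settling_time_function_def by blast
  then have "bdd_above (T ` (- {p}))"
    using settling_time_function_le by (intro bdd_aboveI2) auto
  then show ?thesis
    using T field_continuous field_lyapunov_stable field_eq_0_iff
    by (auto simp: globally_fixed_time_stable_def globally_finite_time_stable_def
        equilibrium_point_def)
qed

end

section \<open>The residual of the inverse quasi-variational inequality\<close>

text \<open>
  A point \<open>x\<close> of a closed convex set is the projection of \<open>w\<close> iff \<open>(w - x) \<bullet> (y - x) \<le> 0\<close> on the set;
  for \<open>w = f u - \<alpha> u\<close> and \<open>x = f u\<close> this is the variational inequality, scaled by \<open>\<alpha>\<close>.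
\<close>

lemma residual_eq_0_iff:
  assumes "\<Phi> u \<noteq> {}" "closed (\<Phi> u)" "convex (\<Phi> u)" and "\<alpha> > 0"
  shows "residual f \<Phi> \<alpha> u = 0 \<longleftrightarrow> iqvip_solution f \<Phi> u"
proof
  assume "residual f \<Phi> \<alpha> u = 0"
  then have eq: "closest_point (\<Phi> u) (f u - \<alpha> *\<^sub>R u) = f u" by (simp add: residual_def)
  have "u \<bullet> (y - f u) \<ge> 0" if "y \<in> \<Phi> u" for y
    using closest_point_dot[OF assms(3,2) that, of "f u - \<alpha> *\<^sub>R u"] \<open>\<alpha> > 0\<close>
    by (simp add: eq zero_le_mult_iff)
  moreover have "f u \<in> \<Phi> u"
    using closest_point_in_set[OF assms(2,1), of "f u - \<alpha> *\<^sub>R u"] by (simp add: eq)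
  ultimately show "iqvip_solution f \<Phi> u" by (simp add: iqvip_solution_def)
next
  assume "iqvip_solution f \<Phi> u"
  then have fu: "f u \<in> \<Phi> u" and vi: "\<And>y. y \<in> \<Phi> u \<Longrightarrow> u \<bullet> (y - f u) \<ge> 0"
    by (auto simp: iqvip_solution_def)
  have "dist (f u - \<alpha> *\<^sub>R u) (f u) \<le> dist (f u - \<alpha> *\<^sub>R u) y" if y: "y \<in> \<Phi> u" for y
  proof -
    have "0 \<le> 2 * \<alpha> * (u \<bullet> (y - f u)) + (y - f u) \<bullet> (y - f u)"
      using vi[OF y] \<open>\<alpha> > 0\<close> by simp
    then show ?thesis
      unfolding dist_norm norm_le by (simp add: algebra_simps inner_commute)
  qed
  then show "residual f \<Phi> \<alpha> u = 0"
    using closest_point_unique[OF assms(3,2) fu] by (simp add: residual_def)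
qed

text \<open>
  Expand the square of the left-hand side and use strong monotonicity on the mixed term.
\<close>

lemma shifted_strongly_monotone_lipschitz:
  assumes f: "L-lipschitz_on UNIV f" "strongly_monotone \<beta> f" and "\<alpha> > 0"
  shows "norm ((f u - \<alpha> *\<^sub>R u) - (f v - \<alpha> *\<^sub>R v))
    \<le> sqrt (L\<^sup>2 + \<alpha>\<^sup>2 - 2 * \<alpha> * \<beta>) * norm (u - v)"
proof -
  let ?F = "f u - f v" and ?d = "u - v"
  have "norm ?F \<le> L * norm ?d"
    using lipschitz_onD[OF f(1), of u v] by (simp add: dist_norm)
  then have "(norm ?F)\<^sup>2 \<le> (L * norm ?d)\<^sup>2" by (intro power_mono) auto
  then have F: "?F \<bullet> ?F \<le> L\<^sup>2 * (norm ?d)\<^sup>2"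
    by (simp add: power2_norm_eq_inner power_mult_distrib)
  have "2 * \<alpha> * (\<beta> * (norm ?d)\<^sup>2) \<le> 2 * \<alpha> * (?F \<bullet> ?d)"
    using f(2) \<open>\<alpha> > 0\<close> by (intro mult_left_mono) (auto simp: strongly_monotone_def)
  moreover have "(norm ((f u - \<alpha> *\<^sub>R u) - (f v - \<alpha> *\<^sub>R v)))\<^sup>2
      = ?F \<bullet> ?F - 2 * \<alpha> * (?F \<bullet> ?d) + \<alpha>\<^sup>2 * (norm ?d)\<^sup>2"
    unfolding power2_norm_eq_inner by (simp add: algebra_simps inner_commute power2_eq_square)
  ultimately have "(norm ((f u - \<alpha> *\<^sub>R u) - (f v - \<alpha> *\<^sub>R v)))\<^sup>2
      \<le> (L\<^sup>2 + \<alpha>\<^sup>2 - 2 * \<alpha> * \<beta>) * (norm ?d)\<^sup>2"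
    using F by (simp add: algebra_simps)
  then show ?thesis
    using real_sqrt_le_mono by (fastforce simp: real_sqrt_mult)
qed

text \<open>
  Change the projected point first, with the set fixed, and then the set, with the point fixed.
\<close>

lemma closest_point_shifted_lipschitz:
  fixes f :: "real ^ 'n \<Rightarrow> real ^ 'n"
  assumes "\<And>u. \<Phi> u \<noteq> {}" "\<And>u. closed (\<Phi> u)" "\<And>u. convex (\<Phi> u)"
    and f: "L-lipschitz_on UNIV f" "strongly_monotone \<beta> f" and \<alpha>: "\<alpha> > 0"
    and \<Phi>: "\<And>u v w. norm (closest_point (\<Phi> u) w - closest_point (\<Phi> v) w) \<le> \<mu> * norm (u - v)"
  shows "norm (closest_point (\<Phi> u) (f u - \<alpha> *\<^sub>R u) - closest_point (\<Phi> v) (f v - \<alpha> *\<^sub>R v))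
    \<le> (sqrt (L\<^sup>2 + \<alpha>\<^sup>2 - 2 * \<alpha> * \<beta>) + \<mu>) * norm (u - v)"
proof -
  let ?x = "f u - \<alpha> *\<^sub>R u" and ?y = "f v - \<alpha> *\<^sub>R v"
  have "norm (closest_point (\<Phi> u) ?x - closest_point (\<Phi> v) ?y)
      \<le> norm (closest_point (\<Phi> u) ?x - closest_point (\<Phi> u) ?y)
        + norm (closest_point (\<Phi> u) ?y - closest_point (\<Phi> v) ?y)"
    by (rule order_trans[OF _ norm_triangle_ineq]) simp
  also have "norm (closest_point (\<Phi> u) ?x - closest_point (\<Phi> u) ?y) \<le> norm (?x - ?y)"
    using closest_point_lipschitz[OF assms(3,2,1), of u ?x ?y] by (simp add: dist_norm)
  finally show ?thesis
    using shifted_strongly_monotone_lipschitz[OF f \<alpha>, of u v] \<Phi>[of u ?y v]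
    by (simp add: algebra_simps)
qed

text \<open>
  Any bound \<open>M\<close> on the settling time has both forms at once. The parameter \<open>s\<close> is chosen to make the second
  one an equality; the first one is then \<open>4 * M / pi\<close>.
\<close>

lemma settling_bound_constants:
  fixes M \<xi> :: real
  assumes "M > 0" "\<xi> > 0"
  defines "s \<equiv> pi * \<xi> / M" and "b1 \<equiv> 1 - 1 / (2 * \<xi>)" and "b2 \<equiv> 1 + 1 / (2 * \<xi>)"
  shows "s > 0" "M \<le> 1 / (s * (1 - b1)) + 1 / (s * (b2 - 1))" "M = pi * \<xi> / sqrt (s * s)"
proof -
  show s: "s > 0" using assms by (simp add: s_def)
  have "M = pi * \<xi> / s" using assms by (simp add: s_def)
  then show "M = pi * \<xi> / sqrt (s * s)" using s by (simp only: real_sqrt_abs2 abs_of_pos)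
  have "1 / (s * (1 - b1)) + 1 / (s * (b2 - 1)) = 4 * M / pi"
    using assms by (simp add: s_def b1_def b2_def)
  moreover have "M * pi \<le> M * 4" using assms pi_less_4 by (intro mult_left_mono) auto
  ultimately show "M \<le> 1 / (s * (1 - b1)) + 1 / (s * (b2 - 1))"
    by (simp add: pos_le_divide_eq mult.commute)
qed

theorem theorem4p2:
  fixes f :: "real ^ 'n \<Rightarrow> real ^ 'n"
    and \<Phi> :: "real ^ 'n \<Rightarrow> (real ^ 'n) set"
    and L \<beta> \<alpha> \<mu> a1 a2 r1 r2 :: real
    and ustar :: "real ^ 'n"
  assumes "\<And>u. \<Phi> u \<noteq> {}" and "\<And>u. closed (\<Phi> u)" and "\<And>u. convex (\<Phi> u)"
    and "L-lipschitz_on UNIV f"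
    and "\<beta> > 0" and "strongly_monotone \<beta> f"
    and "\<alpha> > 0" and "\<mu> > 0"
    and "\<And>u v w. norm (closest_point (\<Phi> u) w - closest_point (\<Phi> v) w) \<le> \<mu> * norm (u - v)"
    and "sqrt (L\<^sup>2 + \<alpha>\<^sup>2 - 2 * \<alpha> * \<beta>) + \<mu> < \<alpha>"
    and "sqrt (L\<^sup>2 + \<alpha>\<^sup>2 - 2 * \<alpha> * \<beta>) + \<mu> < \<beta>"
    and "a1 > 0" and "a2 > 0" and "0 < r1" and "r1 < 1" and "r2 > 1"
    and "equilibrium_point (iqvip_field f \<Phi> \<alpha> a1 a2 r1 r2) ustar"
  shows "iqvip_solution f \<Phi> ustar \<and> (\<forall>v. iqvip_solution f \<Phi> v \<longrightarrow> v = ustar) \<and>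
    globally_fixed_time_stable (iqvip_field f \<Phi> \<alpha> a1 a2 r1 r2) ustar \<and>
    (\<forall>T. settling_time_function (iqvip_field f \<Phi> \<alpha> a1 a2 r1 r2) ustar T \<longrightarrow>
      (\<exists>s1 s2 b1 b2. s1 > 0 \<and> s2 > 0 \<and> 1 / 2 < b1 \<and> b1 < 1 \<and> b2 > 1 \<and>
         (\<forall>u0. u0 \<noteq> ustar \<longrightarrow> T u0 \<le> 1 / (s1 * (1 - b1)) + 1 / (s2 * (b2 - 1))) \<and>
         (\<forall>\<xi>>1. b1 = 1 - 1 / (2 * \<xi>) \<and> b2 = 1 + 1 / (2 * \<xi>) \<longrightarrow>
            (\<forall>u0. u0 \<noteq> ustar \<longrightarrow> T u0 \<le> pi * \<xi> / sqrt (s1 * s2)))) \<and>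
      (\<forall>\<xi>>1. \<exists>s1 s2 b1 b2. s1 > 0 \<and> s2 > 0 \<and>
         b1 = 1 - 1 / (2 * \<xi>) \<and> b2 = 1 + 1 / (2 * \<xi>) \<and>
         (\<forall>u0. u0 \<noteq> ustar \<longrightarrow> T u0 \<le> 1 / (s1 * (1 - b1)) + 1 / (s2 * (b2 - 1))) \<and>
         (\<forall>u0. u0 \<noteq> ustar \<longrightarrow> T u0 \<le> pi * \<xi> / sqrt (s1 * s2))))"
proof -
  let ?R = "residual f \<Phi> \<alpha>"
  define \<theta> where "\<theta> = sqrt (L\<^sup>2 + \<alpha>\<^sup>2 - 2 * \<alpha> * \<beta>) + \<mu>"
  define d where "d u v = closest_point (\<Phi> u) (f u - \<alpha> *\<^sub>R u) - closest_point (\<Phi> v) (f v - \<alpha> *\<^sub>R v)"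
    for u v
  have d: "norm (d u v) \<le> \<theta> * norm (u - v)" for u v
    unfolding d_def \<theta>_def
    by (rule closest_point_shifted_lipschitz) (fact assms)+
  have R_diff: "?R u - ?R v = (f u - f v) - d u v" for u v
    by (simp add: residual_def d_def)
  have R_lipschitz: "norm (?R u - ?R v) \<le> (L + \<theta>) * norm (u - v)" for u v
    using norm_triangle_ineq4[of "f u - f v" "d u v"] d[of u v]
      lipschitz_onD[OF \<open>L-lipschitz_on UNIV f\<close>, of u v]
    unfolding R_diff by (simp add: dist_norm algebra_simps)
  have R_monotone: "(\<beta> - \<theta>) * (norm (u - v))\<^sup>2 \<le> (?R u - ?R v) \<bullet> (u - v)" for u v
  proof -
    have "d u v \<bullet> (u - v) \<le> norm (d u v) * norm (u - v)" by (rule norm_cauchy_schwarz)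
    also have "\<dots> \<le> \<theta> * norm (u - v) * norm (u - v)" by (intro mult_right_mono d) simp
    finally show ?thesis
      using \<open>strongly_monotone \<beta> f\<close> unfolding strongly_monotone_def R_diff
      by (auto simp: inner_diff_left left_diff_distrib power2_eq_square mult.assoc
          intro!: diff_mono)
  qed
  have "L \<ge> 0" using \<open>L-lipschitz_on UNIV f\<close> lipschitz_on_nonneg by blast
  \<comment> \<open>The radicand could be negative as far as its form goes, and then so would be the square root; that
      \<open>\<theta>\<close> is nonnegative follows from the Lipschitz estimate at two distinct points.\<close>
  have "0 \<le> \<theta> * norm (1 :: real ^ 'n)"
    using order_trans[OF norm_ge_zero d[of 1 0]] by simp
  then have "\<theta> \<ge> 0" by (simp add: zero_le_mult_iff)
  have field: "iqvip_field f \<Phi> \<alpha> a1 a2 r1 r2 u = - ((a1 * norm (?R u) powr (r1 - 1)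
      + a2 * norm (?R u) powr (r2 - 1)) *\<^sub>R ?R u)" for u
    using powr_minus_divide[of "norm (?R u)" "1 - r1"] powr_minus_divide[of "norm (?R u)" "1 - r2"]
    by (auto simp: iqvip_field_def gain_def)
  have "?R ustar = 0"
  proof (rule ccontr)
    assume ne: "?R ustar \<noteq> 0"
    then have "a1 * norm (?R ustar) powr (r1 - 1) + a2 * norm (?R ustar) powr (r2 - 1) > 0"
      using \<open>a1 > 0\<close> \<open>a2 > 0\<close> by (intro add_pos_pos mult_pos_pos) auto
    then show False
      using assms(17) ne by (auto simp: equilibrium_point_def field)
  qed
  \<comment> \<open>The summand \<open>1\<close> only serves to make the Lipschitz constant positive.\<close>
  interpret flow: rescaled_flow ?R ustar "L + \<theta> + 1" "\<beta> - \<theta>" a1 a2 r1 r2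
  proof
    show "(L + \<theta> + 1)-lipschitz_on UNIV ?R"
      using \<open>L \<ge> 0\<close> \<open>\<theta> \<ge> 0\<close>
      by (intro lipschitz_onI)
         (auto simp: dist_norm intro!: order_trans[OF R_lipschitz] mult_right_mono)
    show "(\<beta> - \<theta>) * (norm (u - ustar))\<^sup>2 \<le> ?R u \<bullet> (u - ustar)" for u
      using R_monotone[of u ustar] \<open>?R ustar = 0\<close> by simp
  qed (use assms \<open>?R ustar = 0\<close> \<open>L \<ge> 0\<close> \<open>\<theta> \<ge> 0\<close> in \<open>auto simp: \<theta>_def\<close>)
  have flow_field: "iqvip_field f \<Phi> \<alpha> a1 a2 r1 r2 = flow.field"
    by (simp add: fun_eq_iff field flow.field_def flow.speed_def)
  have solution_iff: "iqvip_solution f \<Phi> v \<longleftrightarrow> v = ustar" for v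
    using residual_eq_0_iff[of \<Phi> v \<alpha> f] assms flow.R_eq_0_iff[of v] by blast
  define M where "M = pi / (2 * flow.rate)"
  have M: "M > 0" using flow.rate_pos by (simp add: M_def)
  have bounds: "\<exists>s>0. (\<forall>u0. u0 \<noteq> ustar \<longrightarrow>
      T u0 \<le> 1 / (s * (1 - (1 - 1 / (2 * \<xi>)))) + 1 / (s * (1 + 1 / (2 * \<xi>) - 1))) \<and>
      (\<forall>u0. u0 \<noteq> ustar \<longrightarrow> T u0 \<le> pi * \<xi> / sqrt (s * s))"
    if T: "settling_time_function flow.field ustar T" and \<xi>: "\<xi> > 1" for T \<xi>
  proof -
    have le: "T u0 \<le> M" if "u0 \<noteq> ustar" for u0
      using flow.settling_time_function_le[OF T that] by (simp add: M_def)
    have "\<xi> > 0" using \<xi> by simp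
    note s = settling_bound_constants[OF M this]
    show ?thesis
      using s(1) order_trans[OF le s(2)] order_trans[OF le eq_refl[OF s(3)]] by blast
  qed
  have first: "\<exists>s1 s2 b1 b2. s1 > 0 \<and> s2 > 0 \<and> 1 / 2 < b1 \<and> b1 < 1 \<and> b2 > 1 \<and>
      (\<forall>u0. u0 \<noteq> ustar \<longrightarrow> T u0 \<le> 1 / (s1 * (1 - b1)) + 1 / (s2 * (b2 - 1))) \<and>
      (\<forall>\<xi>>1. b1 = 1 - 1 / (2 * \<xi>) \<and> b2 = 1 + 1 / (2 * \<xi>) \<longrightarrow>
         (\<forall>u0. u0 \<noteq> ustar \<longrightarrow> T u0 \<le> pi * \<xi> / sqrt (s1 * s2)))"
    if T: "settling_time_function flow.field ustar T" for T
  proof -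
    \<comment> \<open>Any \<open>\<xi> > 1\<close> would do for the choice of the exponents. Since \<open>b1\<close> determines \<open>\<xi>\<close>, the addendum for
        matching \<open>\<xi>\<close> concerns only the value chosen here.\<close>
    obtain s where s: "s > 0" "\<forall>u0. u0 \<noteq> ustar \<longrightarrow>
        T u0 \<le> 1 / (s * (1 - (1 - 1 / (2 * 2)))) + 1 / (s * (1 + 1 / (2 * 2) - 1))"
      "\<forall>u0. u0 \<noteq> ustar \<longrightarrow> T u0 \<le> pi * 2 / sqrt (s * s)"
      using bounds[OF T, of 2] by auto
    have "\<xi> = 2" if "\<xi> > 1" "1 - 1 / (2 * 2) = 1 - 1 / (2 * \<xi>)" for \<xi> :: real
      using that by (simp add: field_simps)
    then show ?thesis
      using s by (intro exI[of _ s] exI[of _ "1 - 1 / (2 * 2)"] exI[of _ "1 + 1 / (2 * 2)"] conjI allI impI)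
        auto
  qed
  show ?thesis
    unfolding flow_field
  proof (intro conjI allI impI)
    show "iqvip_solution f \<Phi> ustar" by (simp add: solution_iff)
    show "v = ustar" if "iqvip_solution f \<Phi> v" for v using that by (simp add: solution_iff)
    show "globally_fixed_time_stable flow.field ustar"
      by (rule flow.field_globally_fixed_time_stable)
    fix T assume T: "settling_time_function flow.field ustar T"
    show "\<exists>s1 s2 b1 b2. s1 > 0 \<and> s2 > 0 \<and> 1 / 2 < b1 \<and> b1 < 1 \<and> b2 > 1 \<and>
      (\<forall>u0. u0 \<noteq> ustar \<longrightarrow> T u0 \<le> 1 / (s1 * (1 - b1)) + 1 / (s2 * (b2 - 1))) \<and>
      (\<forall>\<xi>>1. b1 = 1 - 1 / (2 * \<xi>) \<and> b2 = 1 + 1 / (2 * \<xi>) \<longrightarrow>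
         (\<forall>u0. u0 \<noteq> ustar \<longrightarrow> T u0 \<le> pi * \<xi> / sqrt (s1 * s2)))"
      by (rule first[OF T])
    fix \<xi> :: real assume \<xi>: "\<xi> > 1"
    show "\<exists>s1 s2 b1 b2. s1 > 0 \<and> s2 > 0 \<and> b1 = 1 - 1 / (2 * \<xi>) \<and> b2 = 1 + 1 / (2 * \<xi>) \<and>
      (\<forall>u0. u0 \<noteq> ustar \<longrightarrow> T u0 \<le> 1 / (s1 * (1 - b1)) + 1 / (s2 * (b2 - 1))) \<and>
      (\<forall>u0. u0 \<noteq> ustar \<longrightarrow> T u0 \<le> pi * \<xi> / sqrt (s1 * s2))"
      using bounds[OF T \<xi>] by blast
  qed
qed

end
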